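(* Let $D=(v,init(v),next(v,v'),J)$ be a program and $\phi$ a $CTL^*$ formula. For every set of clauses $Clauses(v,init(v),next(v,v'),J,\phi)$ produced by the translation system ${\textsf{Trans}}$, if this set is satisfiable, then $D\models\phi$.
   Context: Fix a first-order background theory $\mathcal{T}$ with domain $\mathcal{E}$; an assertion is a formula of $\mathcal{T}$. A program is $D=(v,init(v),next(v,v'),J)$ where $v$ is a finite tuple of variables, $init(v)$ is an assertion (or a predicate application) over $v$, $next(v,v')$ is an assertion over $v$ and a primed copy $v'$, and $J=\{J_1,\dots,J_k\}$ is a finite list of assertions over $v$ (fairness conditions). States are valuations of $v$ in $\mathcal{E}$; a path is an infinite sequence of states $s_0s_1\dots$ with $next(s_i,s_{i+1})$ for all $i$; a path is fair if every $J_i$ holds at infinitely many of its states (if $J=\emptyset$ every path is fair). $CTL^*$ formulas are in negation normal form (negation only on assertions), built from assertions with $\wedge,\vee$, temporal operators $X,G,U$ (and $F\psi=\mathit{true}\,U\,\psi$), and path quantifiers $A,E$ (over all paths from a state) and $A_f,E_f$ (over fair paths from a state). $D\models\phi$ iff every state satisfying $init$ satisfies $\phi$. A basic state formula is $Q\psi$ with $Q$ a path quantifier and $\psi$ a path formula containing no path quantifiers. $\phi_1(\phi_2)$ denotes a formula with one or more occurrences of a subformula $\phi_2$, and $\phi_1(\gamma)$ the result of replacing them by $\gamma$. Clauses (Existential Horn Clauses) are implications $body\to head$ over uninterpreted predicate symbols, with all free variables universally quantified, where bodies/heads are built from assertions and predicate applications (heads may contain $\exists$), together with constraints $dwf(r)$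 for binary (pairs-of-states) predicates $r$. A set of clauses is satisfiable if there is an interpretation $\mathcal{I}$ assigning to each predicate symbol of arity $n$ a subset of $\mathcal{E}^n$ such that all implications are true for all values of their free variables and, for each constraint $dwf(r)$, $\mathcal{I}(r)$ is disjunctively well-founded (contained in a finite union of well-founded relations). ${\textsf{Trans}}$ is the nondeterministic recursive procedure computing $Clauses(v,init(v),next(v,v'),J,\phi)$ (write $D$ for the first four arguments) by the following rules, each applied whenever its pattern matches; any set obtainable is a result of ${\textsf{Trans}}$. (1) If $\phi_1$ is a basic state subformula of $\phi_2(\phi_1)$, with $aux$ a fresh predicate of arity $|v|$: $Clauses(D,\phi_2(\phi_1))=Clauses(v,aux(v),next,J,\phi_1)\cup Clauses(D,\phi_2(aux(v)))$. (2) For a basic state formula $Q\psi$ with $Q\in\{A,E\}$ and $Q_f$ its fair version: $Clauses(D,Q\psi)=Clauses(v,init,next,\emptyset,Q_f\psi)$. (3) For an assertion $c$ and fresh boolean variable $x_X$: $Clauses(D,A_f\psi(Xc))=Clauses(v\cup\{x_X\},init(v),next\wedge(x_X=c(v')),J,A_f\psi(x_X))$; and with $aux$ fresh of arity $|v|+1$: $Clauses(D,E_f\psi(Xc))=\{init(v)\to\exists x_X\,aux(v,x_X)\}\cup Clauses(v\cup\{x_X\},aux(v,x_X),next\wedge(x_X=c(v')),J,E_f\psi(x_X))$. (4) Same as (3) with $Gc$, fresh $x_G$, conjunct $x_G=(c(v)\wedge x_G')$ added to $next$ and $J$ replaced by $J\cup\{x_G\vee\neg c(v)\}$. (5) Same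 as (3) with $c_1Uc_2$ ($c_1,c_2$ assertions), fresh $x_U$, conjunct $x_U=(c_2(v)\vee(c_1(v)\wedge x_U'))$ added to $next$ and $J$ replaced by $J\cup\{\neg x_U\vee c_2(v)\}$. (6) For an assertion $c$, fresh $p$ (arity $|v|$) and $r,t$ (arity $2|v|$), copies $v_0,\dots,v_k$ of $v$: if $J\ne\emptyset$, $Clauses(D,A_fc)=\{init(v)\wedge\neg c(v)\to p(v),\ next(v,v')\wedge p(v)\to p(v'),\ p(v_0)\wedge\bigwedge_{i=1}^{k}(t(v_{i-1},v_i)\wedge J_i(v_i))\to r(v_0,v_k),\ dwf(r),\ next(v,v')\to t(v,v'),\ t(v,v')\wedge next(v',v'')\to t(v,v'')\}$; if $J=\emptyset$, the same but with the third clause replaced by $p(v)\wedge t(v,v')\to r(v,v')$. (7) For an assertion $c$, fresh $q_1,\dots,q_k$ (arity $|v|$), $r_1,\dots,r_k$ (arity $2|v|$): if $J\neq\emptyset$, $Clauses(D,E_fc)=\{init(v)\to c(v)\wedge q_1(v)\}\cup\{q_i(v)\to\exists v'.\,next(v,v')\wedge((J_i(v)\wedge q_{(i\bmod k)+1}(v'))\vee(r_i(v,v')\wedge q_i(v'))),\ dwf(r_i),\ r_i(v,v')\wedge r_i(v',v'')\to r_i(v,v'')\mid i\le k\}$; if $J=\emptyset$, with $q$ fresh: $\{init(v)\to c(v)\wedge q(v),\ q(v)\to\exists v'.\,next(v,v')\wedge q(v')\}$. (8) For an assertion $c$: $Clauses(D,c)=\{init(v)\to c(v)\}$.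
   Formalization: Rules (3)–(5) are applied only to basic state formulas (ψ without path quantifiers; nested ones are first removed by rule (1)); applied literally across a nested quantifier, e.g. to E_f(A Xc), the translation is unsound. *)

theory Defs
  imports Main "HOL-Library.FuncSet"
begin

section \<open>First-order formulas\<close>

text \<open>Program variables come with a sort. \<^term>\<open>Boolean\<close> variables range over the two truth
  values, which are elements of the domain.\<close>

datatype vsort = Dom | Boolean

datatype pvar = PVar vsort nat

text \<open>\<open>PV x k\<close> is the copy of the program variable \<open>x\<close> with \<open>k\<close> primes (in clauses over
  \<open>v\<^sub>0, \<dots>, v\<^sub>k\<close>, the copy number \<open>k\<close>). Quantifiers inside formulas bind only the
  logical variables \<open>LV s n\<close>, so renaming program variables cannot lead to capture.\<close>

datatype var = PV pvar nat | LV vsort nat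

datatype 'f tm = Var var | Fn 'f "'f tm list"

datatype psym = PSym nat (arity: nat)

text \<open>Formulas of the background theory, extended by applications of uninterpreted predicate
  symbols. \<open>Holds t\<close> uses the term \<open>t\<close> (typically a Boolean variable) as a formula.\<close>

datatype ('f, 'r) fm =
    Tru
  | Holds "'f tm"
  | Eq "'f tm" "'f tm"
  | Rel 'r "'f tm list"
  | PApp psym "'f tm list"
  | Neg "('f, 'r) fm"
  | Conj "('f, 'r) fm" "('f, 'r) fm"
  | Disj "('f, 'r) fm" "('f, 'r) fm"
  | Ex vsort nat "('f, 'r) fm"

abbreviation Iff :: "('f, 'r) fm \<Rightarrow> ('f, 'r) fm \<Rightarrow> ('f, 'r) fm" where
  "Iff a b \<equiv> Disj (Conj a b) (Conj (Neg a) (Neg b))"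

definition conjs :: "('f, 'r) fm list \<Rightarrow> ('f, 'r) fm" where
  "conjs fs = foldr Conj fs Tru"

primrec tm_vars :: "'f tm \<Rightarrow> var set" where
  "tm_vars (Var x) = {x}"
| "tm_vars (Fn f ts) = \<Union> (set (map tm_vars ts))"

primrec fv :: "('f, 'r) fm \<Rightarrow> var set" where
  "fv Tru = {}"
| "fv (Holds t) = tm_vars t"
| "fv (Eq t u) = tm_vars t \<union> tm_vars u"
| "fv (Rel r ts) = \<Union> (tm_vars ` set ts)"
| "fv (PApp p ts) = \<Union> (tm_vars ` set ts)"
| "fv (Neg a) = fv a"
| "fv (Conj a b) = fv a \<union> fv b"
| "fv (Disj a b) = fv a \<union> fv b"
| "fv (Ex s n a) = fv a - {LV s n}"

primrec psyms :: "('f, 'r) fm \<Rightarrow> psym set" where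
  "psyms Tru = {}"
| "psyms (Holds t) = {}"
| "psyms (Eq t u) = {}"
| "psyms (Rel r ts) = {}"
| "psyms (PApp p ts) = {p}"
| "psyms (Neg a) = psyms a"
| "psyms (Conj a b) = psyms a \<union> psyms b"
| "psyms (Disj a b) = psyms a \<union> psyms b"
| "psyms (Ex s n a) = psyms a"

text \<open>\<open>shift k\<close> adds \<open>k\<close> primes to all program variables: it turns \<open>c(v)\<close> into
  \<open>c(v\<^sub>k)\<close> and \<open>next(v,v')\<close> into \<open>next(v\<^sub>k, v\<^sub>k\<^sub>+\<^sub>1)\<close>.\<close>

primrec shift_var :: "nat \<Rightarrow> var \<Rightarrow> var" where
  "shift_var k (PV x j) = PV x (j + k)"
| "shift_var k (LV s n) = LV s n"

primrec shift_tm :: "nat \<Rightarrow> 'f tm \<Rightarrow> 'f tm" where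
  "shift_tm k (Var x) = Var (shift_var k x)"
| "shift_tm k (Fn f ts) = Fn f (map (shift_tm k) ts)"

primrec shift :: "nat \<Rightarrow> ('f, 'r) fm \<Rightarrow> ('f, 'r) fm" where
  "shift k Tru = Tru"
| "shift k (Holds t) = Holds (shift_tm k t)"
| "shift k (Eq t u) = Eq (shift_tm k t) (shift_tm k u)"
| "shift k (Rel r ts) = Rel r (map (shift_tm k) ts)"
| "shift k (PApp p ts) = PApp p (map (shift_tm k) ts)"
| "shift k (Neg a) = Neg (shift k a)"
| "shift k (Conj a b) = Conj (shift k a) (shift k b)"
| "shift k (Disj a b) = Disj (shift k a) (shift k b)"
| "shift k (Ex s n a) = Ex s n (shift k a)"

text \<open>The background theory is given by its intended model, whose domain is all of \<^typ>\<open>'e\<close>.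
  The elements \<open>tt\<close> and \<open>ff\<close> are the truth values.\<close>

record ('f, 'r, 'e) struct =
  funs :: "'f \<Rightarrow> 'e list \<Rightarrow> 'e"
  rels :: "'r \<Rightarrow> 'e list \<Rightarrow> bool"
  tt :: 'e
  ff :: 'e

type_synonym 'e interp = "psym \<Rightarrow> 'e list set"

definition interpretation_of_psyms :: "'e interp \<Rightarrow> bool" where
  "interpretation_of_psyms I \<longleftrightarrow> (\<forall>p. I p \<subseteq> {es. length es = arity p})"

primrec carrier_of :: "('f, 'r, 'e) struct \<Rightarrow> vsort \<Rightarrow> 'e set" where
  "carrier_of M Dom = UNIV"
| "carrier_of M Boolean = {tt M, ff M}"

primrec pvar_sort :: "pvar \<Rightarrow> vsort" where
  "pvar_sort (PVar s n) = s"

primrec var_sort :: "var \<Rightarrow> vsort" where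
  "var_sort (PV x k) = pvar_sort x"
| "var_sort (LV s n) = s"

primrec eval :: "('f, 'r, 'e) struct \<Rightarrow> (var \<Rightarrow> 'e) \<Rightarrow> 'f tm \<Rightarrow> 'e" where
  "eval M \<sigma> (Var x) = \<sigma> x"
| "eval M \<sigma> (Fn f ts) = funs M f (map (eval M \<sigma>) ts)"

primrec sem :: "('f, 'r, 'e) struct \<Rightarrow> 'e interp \<Rightarrow> (var \<Rightarrow> 'e) \<Rightarrow> ('f, 'r) fm \<Rightarrow> bool" where
  "sem M I \<sigma> Tru \<longleftrightarrow> True"
| "sem M I \<sigma> (Holds t) \<longleftrightarrow> eval M \<sigma> t = tt M"
| "sem M I \<sigma> (Eq t u) \<longleftrightarrow> eval M \<sigma> t = eval M \<sigma> u"
| "sem M I \<sigma> (Rel r ts) \<longleftrightarrow> rels M r (map (eval M \<sigma>) ts)"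
| "sem M I \<sigma> (PApp p ts) \<longleftrightarrow> map (eval M \<sigma>) ts \<in> I p"
| "sem M I \<sigma> (Neg a) \<longleftrightarrow> \<not> sem M I \<sigma> a"
| "sem M I \<sigma> (Conj a b) \<longleftrightarrow> sem M I \<sigma> a \<and> sem M I \<sigma> b"
| "sem M I \<sigma> (Disj a b) \<longleftrightarrow> sem M I \<sigma> a \<or> sem M I \<sigma> b"
| "sem M I \<sigma> (Ex s n a) \<longleftrightarrow> (\<exists>d \<in> carrier_of M s. sem M I (\<sigma>(LV s n := d)) a)"


section \<open>Programs\<close>

record ('f, 'r) prog =
  vars :: "pvar list"
  init :: "('f, 'r) fm"
  nxt :: "('f, 'r) fm"
  fair :: "('f, 'r) fm list"

definition copies :: "pvar list \<Rightarrow> nat \<Rightarrow> var list" where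
  "copies vs k = map (\<lambda>x. PV x k) vs"

text \<open>Assertions contain no uninterpreted predicate symbols; the initial condition may also be a
  single predicate application.\<close>

definition assertion_over :: "var set \<Rightarrow> ('f, 'r) fm \<Rightarrow> bool" where
  "assertion_over X a \<longleftrightarrow> psyms a = {} \<and> fv a \<subseteq> X"

definition papp_over :: "var set \<Rightarrow> ('f, 'r) fm \<Rightarrow> bool" where
  "papp_over X a \<longleftrightarrow> (\<exists>p ts. a = PApp p ts \<and> length ts = arity p) \<and> fv a \<subseteq> X"

definition program :: "('f, 'r) prog \<Rightarrow> bool" where
  "program D \<longleftrightarrow>
     distinct (vars D) \<and>
     (assertion_over (set (copies (vars D) 0)) (init D) \<or>
      papp_over (set (copies (vars D) 0)) (init D)) \<and>
     assertion_over (set (copies (vars D) 0) \<union> set (copies (vars D) 1)) (nxt D) \<and>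
     (\<forall>j \<in> set (fair D). assertion_over (set (copies (vars D) 0)) j)"

type_synonym 'e state = "pvar \<Rightarrow> 'e"

definition states :: "('f, 'r, 'e) struct \<Rightarrow> ('f, 'r) prog \<Rightarrow> 'e state set" where
  "states M D = (\<Pi>\<^sub>E x \<in> set (vars D). carrier_of M (pvar_sort x))"

text \<open>The valuation in which the \<open>k\<close>-th copy of the variables is read off the state \<open>S k\<close>.\<close>

primrec valuation :: "(nat \<Rightarrow> 'e state) \<Rightarrow> var \<Rightarrow> 'e" where
  "valuation S (PV x k) = S k x"
| "valuation S (LV s n) = undefined"

definition holds_at ::
    "('f, 'r, 'e) struct \<Rightarrow> 'e interp \<Rightarrow> 'e state \<Rightarrow> ('f, 'r) fm \<Rightarrow> bool" where
  "holds_at M I s a \<longleftrightarrow> sem M I (valuation (\<lambda>_. s)) a"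

definition step ::
    "('f, 'r, 'e) struct \<Rightarrow> 'e interp \<Rightarrow> ('f, 'r) prog \<Rightarrow> 'e state \<Rightarrow> 'e state \<Rightarrow> bool" where
  "step M I D s s' \<longleftrightarrow> sem M I (valuation (\<lambda>k. if k = 0 then s else s')) (nxt D)"

definition is_path ::
    "('f, 'r, 'e) struct \<Rightarrow> 'e interp \<Rightarrow> ('f, 'r) prog \<Rightarrow> (nat \<Rightarrow> 'e state) \<Rightarrow> bool" where
  "is_path M I D \<pi> \<longleftrightarrow> (\<forall>i. \<pi> i \<in> states M D \<and> step M I D (\<pi> i) (\<pi> (Suc i)))"

definition fair_path ::
    "('f, 'r, 'e) struct \<Rightarrow> 'e interp \<Rightarrow> ('f, 'r) prog \<Rightarrow> (nat \<Rightarrow> 'e state) \<Rightarrow> bool" where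
  "fair_path M I D \<pi> \<longleftrightarrow>
     is_path M I D \<pi> \<and> (\<forall>j \<in> set (fair D). infinite {i. holds_at M I (\<pi> i) j})"


section \<open>CTL* in negation normal form\<close>

datatype quant = QA | QE | QAf | QEf

datatype ('f, 'r) sform =
    Asrt "('f, 'r) fm"
  | SAnd "('f, 'r) sform" "('f, 'r) sform"
  | SOr "('f, 'r) sform" "('f, 'r) sform"
  | Quant quant "('f, 'r) pform"
and ('f, 'r) pform =
    PState "('f, 'r) sform"
  | PAnd "('f, 'r) pform" "('f, 'r) pform"
  | POr "('f, 'r) pform" "('f, 'r) pform"
  | PX "('f, 'r) pform"
  | PG "('f, 'r) pform"
  | PU "('f, 'r) pform" "('f, 'r) pform"

abbreviation PF :: "('f, 'r) pform \<Rightarrow> ('f, 'r) pform" where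
  "PF \<psi> \<equiv> PU (PState (Asrt Tru)) \<psi>"

primrec sat_state ::
      "('f, 'r, 'e) struct \<Rightarrow> 'e interp \<Rightarrow> ('f, 'r) prog \<Rightarrow> 'e state \<Rightarrow> ('f, 'r) sform \<Rightarrow> bool"
  and sat_path ::
      "('f, 'r, 'e) struct \<Rightarrow> 'e interp \<Rightarrow> ('f, 'r) prog \<Rightarrow> (nat \<Rightarrow> 'e state) \<Rightarrow> ('f, 'r) pform \<Rightarrow> bool"
where
  "sat_state M I D s (Asrt a) \<longleftrightarrow> holds_at M I s a"
| "sat_state M I D s (SAnd a b) \<longleftrightarrow> sat_state M I D s a \<and> sat_state M I D s b"
| "sat_state M I D s (SOr a b) \<longleftrightarrow> sat_state M I D s a \<or> sat_state M I D s b"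
| "sat_state M I D s (Quant q \<psi>) \<longleftrightarrow>
     (case q of
        QA \<Rightarrow> \<forall>\<pi>. is_path M I D \<pi> \<and> \<pi> 0 = s \<longrightarrow> sat_path M I D \<pi> \<psi>
      | QE \<Rightarrow> \<exists>\<pi>. is_path M I D \<pi> \<and> \<pi> 0 = s \<and> sat_path M I D \<pi> \<psi>
      | QAf \<Rightarrow> \<forall>\<pi>. fair_path M I D \<pi> \<and> \<pi> 0 = s \<longrightarrow> sat_path M I D \<pi> \<psi>
      | QEf \<Rightarrow> \<exists>\<pi>. fair_path M I D \<pi> \<and> \<pi> 0 = s \<and> sat_path M I D \<pi> \<psi>)"
| "sat_path M I D \<pi> (PState a) \<longleftrightarrow> sat_state M I D (\<pi> 0) a"
| "sat_path M I D \<pi> (PAnd a b) \<longleftrightarrow> sat_path M I D \<pi> a \<and> sat_path M I D \<pi> b"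
| "sat_path M I D \<pi> (POr a b) \<longleftrightarrow> sat_path M I D \<pi> a \<or> sat_path M I D \<pi> b"
| "sat_path M I D \<pi> (PX a) \<longleftrightarrow> sat_path M I D (\<lambda>i. \<pi> (Suc i)) a"
| "sat_path M I D \<pi> (PG a) \<longleftrightarrow> (\<forall>n. sat_path M I D (\<lambda>i. \<pi> (n + i)) a)"
| "sat_path M I D \<pi> (PU a b) \<longleftrightarrow>
     (\<exists>n. sat_path M I D (\<lambda>i. \<pi> (n + i)) b \<and> (\<forall>m<n. sat_path M I D (\<lambda>i. \<pi> (m + i)) a))"

text \<open>\<open>D \<Turnstile> \<phi>\<close>, relative to an interpretation of the predicate symbols. Unless the initial condition
  of \<open>D\<close> is a predicate application, the interpretation is irrelevant, and quantifying over it
  gives the plain notion.\<close>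

definition models_in ::
    "('f, 'r, 'e) struct \<Rightarrow> 'e interp \<Rightarrow> ('f, 'r) prog \<Rightarrow> ('f, 'r) sform \<Rightarrow> bool" where
  "models_in M I D \<phi> \<longleftrightarrow>
     (\<forall>s \<in> states M D. holds_at M I s (init D) \<longrightarrow> sat_state M I D s \<phi>)"

definition models :: "('f, 'r, 'e) struct \<Rightarrow> ('f, 'r) prog \<Rightarrow> ('f, 'r) sform \<Rightarrow> bool" where
  "models M D \<phi> \<longleftrightarrow> (\<forall>I. interpretation_of_psyms I \<longrightarrow> models_in M I D \<phi>)"

primrec sform_asserts :: "('f, 'r) sform \<Rightarrow> ('f, 'r) fm set"
  and pform_asserts :: "('f, 'r) pform \<Rightarrow> ('f, 'r) fm set"
where
  "sform_asserts (Asrt a) = {a}"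
| "sform_asserts (SAnd a b) = sform_asserts a \<union> sform_asserts b"
| "sform_asserts (SOr a b) = sform_asserts a \<union> sform_asserts b"
| "sform_asserts (Quant q \<psi>) = pform_asserts \<psi>"
| "pform_asserts (PState a) = sform_asserts a"
| "pform_asserts (PAnd a b) = pform_asserts a \<union> pform_asserts b"
| "pform_asserts (POr a b) = pform_asserts a \<union> pform_asserts b"
| "pform_asserts (PX a) = pform_asserts a"
| "pform_asserts (PG a) = pform_asserts a"
| "pform_asserts (PU a b) = pform_asserts a \<union> pform_asserts b"

definition ctl_star_over :: "pvar list \<Rightarrow> ('f, 'r) sform \<Rightarrow> bool" where
  "ctl_star_over vs \<phi> \<longleftrightarrow> (\<forall>a \<in> sform_asserts \<phi>. assertion_over (set (copies vs 0)) a)"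

primrec quant_free_state :: "('f, 'r) sform \<Rightarrow> bool"
  and quant_free :: "('f, 'r) pform \<Rightarrow> bool"
where
  "quant_free_state (Asrt a) \<longleftrightarrow> True"
| "quant_free_state (SAnd a b) \<longleftrightarrow> quant_free_state a \<and> quant_free_state b"
| "quant_free_state (SOr a b) \<longleftrightarrow> quant_free_state a \<and> quant_free_state b"
| "quant_free_state (Quant q \<psi>) \<longleftrightarrow> False"
| "quant_free (PState a) \<longleftrightarrow> quant_free_state a"
| "quant_free (PAnd a b) \<longleftrightarrow> quant_free a \<and> quant_free b"
| "quant_free (POr a b) \<longleftrightarrow> quant_free a \<and> quant_free b"
| "quant_free (PX a) \<longleftrightarrow> quant_free a"
| "quant_free (PG a) \<longleftrightarrow> quant_free a"
| "quant_free (PU a b) \<longleftrightarrow> quant_free a \<and> quant_free b"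

text \<open>A conjunction or disjunction of assertions is again an assertion. Since the CTL* connectives
  are separate constructors, the following relations identify the formulas that are assertions
  in this sense. Applications of predicate symbols count as assertions here, as they are
  substituted for state subformulas during the translation.\<close>

inductive state_is_assertion :: "('f, 'r) sform \<Rightarrow> ('f, 'r) fm \<Rightarrow> bool" where
  "state_is_assertion (Asrt a) a"
| "state_is_assertion \<phi> a \<Longrightarrow> state_is_assertion \<phi>' b \<Longrightarrow>
     state_is_assertion (SAnd \<phi> \<phi>') (Conj a b)"
| "state_is_assertion \<phi> a \<Longrightarrow> state_is_assertion \<phi>' b \<Longrightarrow>
     state_is_assertion (SOr \<phi> \<phi>') (Disj a b)"

inductive path_is_assertion :: "('f, 'r) pform \<Rightarrow> ('f, 'r) fm \<Rightarrow> bool" where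
  "state_is_assertion \<phi> a \<Longrightarrow> path_is_assertion (PState \<phi>) a"
| "path_is_assertion \<psi> a \<Longrightarrow> path_is_assertion \<psi>' b \<Longrightarrow>
     path_is_assertion (PAnd \<psi> \<psi>') (Conj a b)"
| "path_is_assertion \<psi> a \<Longrightarrow> path_is_assertion \<psi>' b \<Longrightarrow>
     path_is_assertion (POr \<psi> \<psi>') (Disj a b)"

text \<open>\<open>replace_state \<alpha> \<gamma> \<phi> \<phi>'\<close> and \<open>replace_state_in_path \<alpha> \<gamma> \<psi> \<psi>'\<close>: some (possibly no) occurrences
  of the state subformula \<open>\<alpha>\<close> are replaced by \<open>\<gamma>\<close>. Wherever they are used below, \<open>\<gamma>\<close> differs
  from \<open>\<alpha>\<close>, so \<open>\<phi>' \<noteq> \<phi>\<close> says that at least one occurrence is replaced. The same holds for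
  \<open>replace_path\<close>, which replaces occurrences of a path subformula outside path quantifiers.\<close>

inductive replace_state ::
      "('f, 'r) sform \<Rightarrow> ('f, 'r) sform \<Rightarrow> ('f, 'r) sform \<Rightarrow> ('f, 'r) sform \<Rightarrow> bool"
  and replace_state_in_path ::
      "('f, 'r) sform \<Rightarrow> ('f, 'r) sform \<Rightarrow> ('f, 'r) pform \<Rightarrow> ('f, 'r) pform \<Rightarrow> bool"
  for \<alpha> \<gamma> :: "('f, 'r) sform"
where
  "replace_state \<alpha> \<gamma> \<alpha> \<gamma>"
| "replace_state \<alpha> \<gamma> \<phi> \<phi>"
| "replace_state \<alpha> \<gamma> a a' \<Longrightarrow> replace_state \<alpha> \<gamma> b b' \<Longrightarrow> replace_state \<alpha> \<gamma> (SAnd a b) (SAnd a' b')"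
| "replace_state \<alpha> \<gamma> a a' \<Longrightarrow> replace_state \<alpha> \<gamma> b b' \<Longrightarrow> replace_state \<alpha> \<gamma> (SOr a b) (SOr a' b')"
| "replace_state_in_path \<alpha> \<gamma> \<psi> \<psi>' \<Longrightarrow> replace_state \<alpha> \<gamma> (Quant q \<psi>) (Quant q \<psi>')"
| "replace_state \<alpha> \<gamma> a a' \<Longrightarrow> replace_state_in_path \<alpha> \<gamma> (PState a) (PState a')"
| "replace_state_in_path \<alpha> \<gamma> a a' \<Longrightarrow> replace_state_in_path \<alpha> \<gamma> b b' \<Longrightarrow>
     replace_state_in_path \<alpha> \<gamma> (PAnd a b) (PAnd a' b')"
| "replace_state_in_path \<alpha> \<gamma> a a' \<Longrightarrow> replace_state_in_path \<alpha> \<gamma> b b' \<Longrightarrow>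
     replace_state_in_path \<alpha> \<gamma> (POr a b) (POr a' b')"
| "replace_state_in_path \<alpha> \<gamma> a a' \<Longrightarrow> replace_state_in_path \<alpha> \<gamma> (PX a) (PX a')"
| "replace_state_in_path \<alpha> \<gamma> a a' \<Longrightarrow> replace_state_in_path \<alpha> \<gamma> (PG a) (PG a')"
| "replace_state_in_path \<alpha> \<gamma> a a' \<Longrightarrow> replace_state_in_path \<alpha> \<gamma> b b' \<Longrightarrow>
     replace_state_in_path \<alpha> \<gamma> (PU a b) (PU a' b')"

inductive replace_path ::
      "('f, 'r) pform \<Rightarrow> ('f, 'r) pform \<Rightarrow> ('f, 'r) pform \<Rightarrow> ('f, 'r) pform \<Rightarrow> bool"
  for \<rho> \<gamma> :: "('f, 'r) pform"
where
  "replace_path \<rho> \<gamma> \<rho> \<gamma>"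
| "replace_path \<rho> \<gamma> \<psi> \<psi>"
| "replace_path \<rho> \<gamma> a a' \<Longrightarrow> replace_path \<rho> \<gamma> b b' \<Longrightarrow> replace_path \<rho> \<gamma> (PAnd a b) (PAnd a' b')"
| "replace_path \<rho> \<gamma> a a' \<Longrightarrow> replace_path \<rho> \<gamma> b b' \<Longrightarrow> replace_path \<rho> \<gamma> (POr a b) (POr a' b')"
| "replace_path \<rho> \<gamma> a a' \<Longrightarrow> replace_path \<rho> \<gamma> (PX a) (PX a')"
| "replace_path \<rho> \<gamma> a a' \<Longrightarrow> replace_path \<rho> \<gamma> (PG a) (PG a')"
| "replace_path \<rho> \<gamma> a a' \<Longrightarrow> replace_path \<rho> \<gamma> b b' \<Longrightarrow> replace_path \<rho> \<gamma> (PU a b) (PU a' b')"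


section \<open>Existential Horn clauses\<close>

text \<open>\<open>Clause body xs head\<close> is \<open>body \<rightarrow> \<exists>xs. head\<close>, with all other free variables universally
  quantified; \<open>Dwf r\<close> is the constraint \<open>dwf(r)\<close>.\<close>

datatype ('f, 'r) clause =
    Clause "('f, 'r) fm" "var list" "('f, 'r) fm"
  | Dwf psym

text \<open>A binary predicate on states of \<open>n\<close> variables is a predicate symbol of arity \<open>2n\<close>.\<close>

definition state_rel :: "'e interp \<Rightarrow> psym \<Rightarrow> ('e list \<times> 'e list) set" where
  "state_rel I r =
     {(a, b). length a = arity r div 2 \<and> length b = arity r div 2 \<and> a @ b \<in> I r}"

text \<open>Well-foundedness of \<open>R\<close> means that there is no infinite sequence with
  \<open>(s\<^sub>i, s\<^sub>i\<^sub>+\<^sub>1) \<in> R\<close>, which is \<^const>\<open>wf\<close> of the converse.\<close>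

definition disjunctively_wf :: "('a \<times> 'a) set \<Rightarrow> bool" where
  "disjunctively_wf R \<longleftrightarrow>
     (\<exists>\<W>. finite \<W> \<and> (\<forall>W \<in> \<W>. wf (W\<inverse>)) \<and> R \<subseteq> \<Union> \<W>)"

definition well_sorted :: "('f, 'r, 'e) struct \<Rightarrow> (var \<Rightarrow> 'e) \<Rightarrow> bool" where
  "well_sorted M \<sigma> \<longleftrightarrow> (\<forall>x. \<sigma> x \<in> carrier_of M (var_sort x))"

primrec clause_true :: "('f, 'r, 'e) struct \<Rightarrow> 'e interp \<Rightarrow> ('f, 'r) clause \<Rightarrow> bool" where
  "clause_true M I (Clause b xs h) \<longleftrightarrow>
     (\<forall>\<sigma>. well_sorted M \<sigma> \<and> sem M I \<sigma> b \<longrightarrow>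
        (\<exists>\<tau>. well_sorted M \<tau> \<and> (\<forall>y. y \<notin> set xs \<longrightarrow> \<tau> y = \<sigma> y) \<and> sem M I \<tau> h))"
| "clause_true M I (Dwf r) \<longleftrightarrow> disjunctively_wf (state_rel I r)"

definition solution :: "('f, 'r, 'e) struct \<Rightarrow> 'e interp \<Rightarrow> ('f, 'r) clause set \<Rightarrow> bool" where
  "solution M I C \<longleftrightarrow> interpretation_of_psyms I \<and> (\<forall>cl \<in> C. clause_true M I cl)"

definition satisfiable :: "('f, 'r, 'e) struct \<Rightarrow> ('f, 'r) clause set \<Rightarrow> bool" where
  "satisfiable M C \<longleftrightarrow> (\<exists>I. solution M I C)"


section \<open>The translation\<close>

text \<open>\<open>app p vs [k\<^sub>1, \<dots>, k\<^sub>m]\<close> is the application \<open>p(v\<^sub>k\<^sub>1, \<dots>, v\<^sub>k\<^sub>m)\<close> to copies of the tuple \<open>vs\<close>.\<close>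

definition app :: "psym \<Rightarrow> pvar list \<Rightarrow> nat list \<Rightarrow> ('f, 'r) fm" where
  "app p vs ks = PApp p (map Var (concat (map (copies vs) ks)))"

abbreviation bvar :: "pvar \<Rightarrow> nat \<Rightarrow> ('f, 'r) fm" where
  "bvar x k \<equiv> Holds (Var (PV x k))"

text \<open>\<open>temporal x \<rho> \<delta> Js\<close>: eliminating the temporal formula \<open>\<rho>\<close> by means of the Boolean variable \<open>x\<close>
  adds the conjunct \<open>\<delta>\<close> to the transition relation and \<open>Js\<close> to the fairness conditions.\<close>

inductive temporal ::
    "pvar \<Rightarrow> ('f, 'r) pform \<Rightarrow> ('f, 'r) fm \<Rightarrow> ('f, 'r) fm list \<Rightarrow> bool" where
  temporal_X: "path_is_assertion \<psi> c \<Longrightarrow>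
     temporal x (PX \<psi>) (Iff (bvar x 0) (shift 1 c)) []"
| temporal_G: "path_is_assertion \<psi> c \<Longrightarrow>
     temporal x (PG \<psi>) (Iff (bvar x 0) (Conj c (bvar x 1))) [Disj (bvar x 0) (Neg c)]"
| temporal_U: "path_is_assertion \<psi>\<^sub>1 c\<^sub>1 \<Longrightarrow> path_is_assertion \<psi>\<^sub>2 c\<^sub>2 \<Longrightarrow>
     temporal x (PU \<psi>\<^sub>1 \<psi>\<^sub>2) (Iff (bvar x 0) (Disj c\<^sub>2 (Conj c\<^sub>1 (bvar x 1))))
       [Disj (Neg (bvar x 0)) c\<^sub>2]"

definition fresh_bool :: "pvar \<Rightarrow> ('f, 'r) prog \<Rightarrow> bool" where
  "fresh_bool x D \<longleftrightarrow> pvar_sort x = Boolean \<and> x \<notin> set (vars D)"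

definition clauses_Af ::
    "('f, 'r) prog \<Rightarrow> ('f, 'r) fm \<Rightarrow> psym \<Rightarrow> psym \<Rightarrow> psym \<Rightarrow> ('f, 'r) clause set" where
  "clauses_Af D c p r t =
     (let v = vars D; k = length (fair D) in
      {Clause (Conj (init D) (Neg c)) [] (app p v [0]),
       Clause (Conj (nxt D) (app p v [0])) [] (app p v [1]),
       (if fair D \<noteq> []
        then Clause
               (Conj (app p v [0])
                  (conjs (map (\<lambda>i. Conj (app t v [i, Suc i]) (shift (Suc i) (fair D ! i))) [0..<k])))
               [] (app r v [0, k])
        else Clause (Conj (app p v [0]) (app t v [0, 1])) [] (app r v [0, 1])),
       Dwf r,
       Clause (nxt D) [] (app t v [0, 1]),
       Clause (Conj (app t v [0, 1]) (shift 1 (nxt D))) [] (app t v [0, 2])})"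

text \<open>With fairness conditions \<open>J\<^sub>0, \<dots>, J\<^sub>k\<^sub>-\<^sub>1\<close> counted from zero, the cyclic successor of
  \<open>i\<close> is \<open>Suc i mod k\<close>.\<close>

definition clauses_Ef_fair ::
    "('f, 'r) prog \<Rightarrow> ('f, 'r) fm \<Rightarrow> psym list \<Rightarrow> psym list \<Rightarrow> ('f, 'r) clause set" where
  "clauses_Ef_fair D c qs rs =
     (let v = vars D; k = length (fair D) in
      {Clause (init D) [] (Conj c (app (qs ! 0) v [0]))} \<union>
      (\<Union>i<k.
        {Clause (app (qs ! i) v [0]) (copies v 1)
           (Conj (nxt D)
              (Disj (Conj (fair D ! i) (app (qs ! (Suc i mod k)) v [1]))
                    (Conj (app (rs ! i) v [0, 1]) (app (qs ! i) v [1])))),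
         Dwf (rs ! i),
         Clause (Conj (app (rs ! i) v [0, 1]) (app (rs ! i) v [1, 2])) [] (app (rs ! i) v [0, 2])}))"

definition clauses_Ef_nofair ::
    "('f, 'r) prog \<Rightarrow> ('f, 'r) fm \<Rightarrow> psym \<Rightarrow> ('f, 'r) clause set" where
  "clauses_Ef_nofair D c q =
     (let v = vars D in
      {Clause (init D) [] (Conj c (app q v [0])),
       Clause (app q v [0]) (copies v 1) (Conj (nxt D) (app q v [1]))})"

text \<open>\<open>trans_run U D \<phi> C U'\<close>: one possible run of the procedure on \<open>D\<close> and \<open>\<phi>\<close> yields the clauses \<open>C\<close>.
  The set of predicate symbols in use is \<open>U\<close> before and \<open>U'\<close> after the run; fresh symbols are
  taken from outside this set, so different branches never share a fresh symbol.\<close>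

inductive trans_run ::
    "psym set \<Rightarrow> ('f, 'r) prog \<Rightarrow> ('f, 'r) sform \<Rightarrow> ('f, 'r) clause set \<Rightarrow> psym set \<Rightarrow> bool" where
  split_state:
    "aux \<notin> U \<Longrightarrow> arity aux = length (vars D) \<Longrightarrow>
     quant_free \<psi> \<Longrightarrow>
     replace_state (Quant q \<psi>) (Asrt (app aux (vars D) [0])) \<phi> \<phi>' \<Longrightarrow> \<phi>' \<noteq> \<phi> \<Longrightarrow>
     trans_run (insert aux U) (D\<lparr>init := app aux (vars D) [0]\<rparr>) (Quant q \<psi>) C\<^sub>1 U\<^sub>1 \<Longrightarrow>
     trans_run U\<^sub>1 D \<phi>' C\<^sub>2 U\<^sub>2 \<Longrightarrow>
     trans_run U D \<phi> (C\<^sub>1 \<union> C\<^sub>2) U\<^sub>2"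
| make_fair_A:
    "quant_free \<psi> \<Longrightarrow> trans_run U (D\<lparr>fair := []\<rparr>) (Quant QAf \<psi>) C U' \<Longrightarrow>
     trans_run U D (Quant QA \<psi>) C U'"
| make_fair_E:
    "quant_free \<psi> \<Longrightarrow> trans_run U (D\<lparr>fair := []\<rparr>) (Quant QEf \<psi>) C U' \<Longrightarrow>
     trans_run U D (Quant QE \<psi>) C U'"
| temporal_Af:
    "quant_free \<psi> \<Longrightarrow> fresh_bool x D \<Longrightarrow> temporal x \<rho> \<delta> Js \<Longrightarrow>
     replace_path \<rho> (PState (Asrt (bvar x 0))) \<psi> \<psi>' \<Longrightarrow> \<psi>' \<noteq> \<psi> \<Longrightarrow>
     trans_run U
       \<lparr>vars = vars D @ [x], init = init D, nxt = Conj (nxt D) \<delta>, fair = fair D @ Js\<rparr>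
       (Quant QAf \<psi>') C U' \<Longrightarrow>
     trans_run U D (Quant QAf \<psi>) C U'"
| temporal_Ef:
    "quant_free \<psi> \<Longrightarrow> fresh_bool x D \<Longrightarrow> temporal x \<rho> \<delta> Js \<Longrightarrow>
     replace_path \<rho> (PState (Asrt (bvar x 0))) \<psi> \<psi>' \<Longrightarrow> \<psi>' \<noteq> \<psi> \<Longrightarrow>
     aux \<notin> U \<Longrightarrow> arity aux = length (vars D) + 1 \<Longrightarrow>
     trans_run (insert aux U)
       \<lparr>vars = vars D @ [x], init = app aux (vars D @ [x]) [0],
        nxt = Conj (nxt D) \<delta>, fair = fair D @ Js\<rparr>
       (Quant QEf \<psi>') C U' \<Longrightarrow>
     trans_run U D (Quant QEf \<psi>)
       (insert (Clause (init D) [PV x 0] (app aux (vars D @ [x]) [0])) C) U'"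
| assertion_Af:
    "path_is_assertion \<psi> c \<Longrightarrow>
     distinct [p, r, t] \<Longrightarrow> {p, r, t} \<inter> U = {} \<Longrightarrow>
     arity p = length (vars D) \<Longrightarrow> arity r = 2 * length (vars D) \<Longrightarrow>
     arity t = 2 * length (vars D) \<Longrightarrow>
     trans_run U D (Quant QAf \<psi>) (clauses_Af D c p r t) (U \<union> {p, r, t})"
| assertion_Ef_fair:
    "path_is_assertion \<psi> c \<Longrightarrow> fair D \<noteq> [] \<Longrightarrow>
     length qs = length (fair D) \<Longrightarrow> length rs = length (fair D) \<Longrightarrow>
     distinct (qs @ rs) \<Longrightarrow> set (qs @ rs) \<inter> U = {} \<Longrightarrow>
     \<forall>q \<in> set qs. arity q = length (vars D) \<Longrightarrow>
     \<forall>r \<in> set rs. arity r = 2 * length (vars D) \<Longrightarrow>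
     trans_run U D (Quant QEf \<psi>) (clauses_Ef_fair D c qs rs) (U \<union> set (qs @ rs))"
| assertion_Ef_nofair:
    "path_is_assertion \<psi> c \<Longrightarrow> fair D = [] \<Longrightarrow>
     q \<notin> U \<Longrightarrow> arity q = length (vars D) \<Longrightarrow>
     trans_run U D (Quant QEf \<psi>) (clauses_Ef_nofair D c q) (insert q U)"
| assertion_init:
    "state_is_assertion \<phi> c \<Longrightarrow> trans_run U D \<phi> {Clause (init D) [] c} U"

definition Trans_result :: "('f, 'r) prog \<Rightarrow> ('f, 'r) sform \<Rightarrow> ('f, 'r) clause set \<Rightarrow> bool" where
  "Trans_result D \<phi> C \<longleftrightarrow> (\<exists>U'. trans_run (psyms (init D)) D \<phi> C U')"

end

theory Submission
  imports Defs "HOL-Library.Ramsey"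
begin

text \<open>The interpretation that solves the clauses is fixed once and for all, and every rule of the
  translation is shown to be sound relative to it. Replacing a state subformula by an
  underapproximation is sound since formulas are in negation normal form. Along fair paths of the
  extended program, the Boolean variable introduced for a temporal formula is true exactly where
  the formula holds, and each path has exactly one such labelling. For \<open>A\<^sub>f c\<close>, a fair
  path violating \<open>c\<close> contains an infinite sequence of states any two of which are related by
  \<open>r\<close>; by Ramsey's theorem this contradicts disjunctive well-foundedness. For \<open>E\<^sub>f c\<close>, a path is
  built by dependent choice, and the same argument shows that it cannot wait forever for a fairness
  condition.\<close>

section \<open>Formulas and valuations\<close>

lemma eval_cong: "(\<And>x. x \<in> tm_vars t \<Longrightarrow> \<sigma> x = \<tau> x) \<Longrightarrow> eval M \<sigma> t = eval M \<tau> t"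
proof (induction t)
  case (Fn f ts)
  then have "map (eval M \<sigma>) ts = map (eval M \<tau>) ts" by auto
  then show ?case by (metis eval.simps(2))
qed simp

lemma sem_cong: "(\<And>x. x \<in> fv a \<Longrightarrow> \<sigma> x = \<tau> x) \<Longrightarrow> sem M I \<sigma> a = sem M I \<tau> a"
proof (induction a arbitrary: \<sigma> \<tau>)
  case (Rel r ts)
  then have "map (eval M \<sigma>) ts = map (eval M \<tau>) ts" by (auto intro!: eval_cong)
  then show ?case by (metis sem.simps(4))
next
  case (PApp p ts)
  then have "map (eval M \<sigma>) ts = map (eval M \<tau>) ts" by (auto intro!: eval_cong)
  then show ?case by (metis sem.simps(5))
next
  case (Ex s n a)
  have "sem M I (\<sigma>(LV s n := d)) a = sem M I (\<tau>(LV s n := d)) a" for d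
    using Ex.prems by (intro Ex.IH) auto
  then show ?case by simp
next
  case (Holds t)
  then show ?case using eval_cong[of t \<sigma> \<tau> M] by simp
next
  case (Eq t u)
  then show ?case using eval_cong[of t \<sigma> \<tau> M] eval_cong[of u \<sigma> \<tau> M] by simp
next
  case (Conj a b)
  from Conj.prems show ?case
    using Conj.IH(1)[of \<sigma> \<tau>] Conj.IH(2)[of \<sigma> \<tau>] by simp
next
  case (Disj a b)
  from Disj.prems show ?case
    using Disj.IH(1)[of \<sigma> \<tau>] Disj.IH(2)[of \<sigma> \<tau>] by simp
next
  case (Neg a)
  from Neg.prems show ?case
    using Neg.IH[of \<sigma> \<tau>] by simp
qed simp

lemma eval_shift_tm: "eval M \<sigma> (shift_tm k t) = eval M (\<sigma> \<circ> shift_var k) t"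
proof (induction t)
  case (Fn f ts)
  then have "map (eval M \<sigma> \<circ> shift_tm k) ts = map (eval M (\<sigma> \<circ> shift_var k)) ts"
    by (simp add: comp_def)
  then show ?case by (simp only: shift_tm.simps eval.simps map_map)
qed simp

lemma sem_shift: "sem M I \<sigma> (shift k a) = sem M I (\<sigma> \<circ> shift_var k) a"
proof (induction a arbitrary: \<sigma>)
  case (Ex s n a)
  \<comment> \<open>Quantifiers bind logical variables only, and \<open>shift_var\<close> fixes
    these, so updating a bound variable commutes with shifting.\<close>
  have "\<sigma>(LV s n := d) \<circ> shift_var k = (\<sigma> \<circ> shift_var k)(LV s n := d)" for d
  proof
    show "(\<sigma>(LV s n := d) \<circ> shift_var k) x = ((\<sigma> \<circ> shift_var k)(LV s n := d)) x" for x
      by (cases x) auto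
  qed
  then show ?case by (simp only: shift.simps sem.simps Ex.IH)
qed (simp_all add: eval_shift_tm comp_def)

lemma tm_vars_shift_tm: "tm_vars (shift_tm k t) = shift_var k ` tm_vars t"
  by (induction t) auto

lemma fv_shift: "fv (shift k a) \<subseteq> shift_var k ` fv a"
proof (induction a)
  case (Ex s n a)
  have "LV s n \<in> shift_var k ` X" if "LV s n \<in> X" for X
    using that by (metis image_eqI shift_var.simps(2))
  with Ex show ?case by fastforce
qed (auto simp: tm_vars_shift_tm)

lemma sem_psyms_empty: "psyms a = {} \<Longrightarrow> sem M I \<sigma> a = sem M I' \<sigma> a"
  by (induction a arbitrary: \<sigma>) auto

lemma sem_conjs: "sem M I \<sigma> (conjs fs) \<longleftrightarrow> (\<forall>f \<in> set fs. sem M I \<sigma> f)"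
  by (induction fs) (auto simp: conjs_def)

abbreviation over :: "pvar list \<Rightarrow> ('f, 'r) fm \<Rightarrow> bool" where
  "over vs a \<equiv> fv a \<subseteq> set (copies vs 0)"

abbreviation over2 :: "pvar list \<Rightarrow> ('f, 'r) fm \<Rightarrow> bool" where
  "over2 vs a \<equiv> fv a \<subseteq> set (copies vs 0) \<union> set (copies vs (Suc 0))"

lemma in_copies: "y \<in> set (copies vs k) \<longleftrightarrow> (\<exists>x \<in> set vs. y = PV x k)"
  by (auto simp: copies_def)

text \<open>Takes an arbitrary formula instead of \<open>nxt D\<close>, so that the conjuncts added
  for temporal formulas can be treated separately from the transition relation.\<close>

definition holds_step ::
    "('f, 'r, 'e) struct \<Rightarrow> 'e interp \<Rightarrow> 'e state \<Rightarrow> 'e state \<Rightarrow> ('f, 'r) fm \<Rightarrow> bool" where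
  "holds_step M I s s' a \<longleftrightarrow> sem M I (valuation (\<lambda>k. if k = 0 then s else s')) a"

lemma step_iff: "step M I D s s' \<longleftrightarrow> holds_step M I s s' (nxt D)"
  by (simp add: step_def holds_step_def)

text \<open>Only the values of \<open>\<sigma>\<close> on copy \<open>k\<close> of the program
  variables are constrained. Hence this applies both to clause valuations and to the valuations
  returned by existential clauses.\<close>

lemma sem_shift_holds_at:
  assumes "over vs a" "\<And>x. x \<in> set vs \<Longrightarrow> \<sigma> (PV x k) = s x"
  shows "sem M I \<sigma> (shift k a) \<longleftrightarrow> holds_at M I s a"
  unfolding sem_shift holds_at_def using assms
  by (intro sem_cong) (auto simp: in_copies dest!: subsetD)

lemma sem_shift_holds_step:
  assumes "over2 vs a" "\<And>x. x \<in> set vs \<Longrightarrow> \<sigma> (PV x k) = s x"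
    "\<And>x. x \<in> set vs \<Longrightarrow> \<sigma> (PV x (Suc k)) = s' x"
  shows "sem M I \<sigma> (shift k a) \<longleftrightarrow> holds_step M I s s' a"
  unfolding sem_shift holds_step_def using assms
  by (intro sem_cong) (auto simp: in_copies dest!: subsetD)

lemma sem_shift_0: "sem M I \<sigma> (shift 0 a) = sem M I \<sigma> a"
proof -
  have "\<sigma> \<circ> shift_var 0 = \<sigma>"
  proof
    show "(\<sigma> \<circ> shift_var 0) x = \<sigma> x" for x by (cases x) auto
  qed
  then show ?thesis by (simp add: sem_shift)
qed

lemmas sem_holds_at = sem_shift_holds_at[where k = 0, unfolded sem_shift_0]
lemmas sem_holds_step = sem_shift_holds_step[where k = 0, unfolded sem_shift_0]

lemma holds_at_cong:
  assumes "over vs a" "\<And>x. x \<in> set vs \<Longrightarrow> s x = s' x"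
  shows "holds_at M I s a \<longleftrightarrow> holds_at M I s' a"
  by (subst holds_at_def, rule sem_holds_at[OF assms(1)]) (simp add: assms(2))

lemma holds_step_cong:
  assumes "over2 vs a" "\<And>x. x \<in> set vs \<Longrightarrow> s x = u x" "\<And>x. x \<in> set vs \<Longrightarrow> s' x = u' x"
  shows "holds_step M I s s' a \<longleftrightarrow> holds_step M I u u' a"
  by (subst holds_step_def, rule sem_holds_step[OF assms(1)]) (simp_all add: assms(2,3))

lemma holds_step_shift_1:
  "over vs a \<Longrightarrow> holds_step M I s s' (shift 1 a) \<longleftrightarrow> holds_at M I s' a"
  unfolding holds_step_def by (rule sem_shift_holds_at) auto

lemma holds_step_current:
  "over vs a \<Longrightarrow> holds_step M I s s' a \<longleftrightarrow> holds_at M I s a"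
  unfolding holds_step_def by (rule sem_holds_at) auto

lemma sem_app:
  "sem M I \<sigma> (app p vs ks) \<longleftrightarrow> concat (map (\<lambda>k. map (\<lambda>x. \<sigma> (PV x k)) vs) ks) \<in> I p"
proof -
  have "map (eval M \<sigma>) (map Var (concat (map (copies vs) ks))) =
      concat (map (\<lambda>k. map (\<lambda>x. \<sigma> (PV x k)) vs) ks)"
    by (simp add: map_concat comp_def copies_def)
  then show ?thesis by (simp only: app_def sem.simps)
qed

lemma sem_app_agree:
  assumes "\<And>k x. k \<in> set ks \<Longrightarrow> x \<in> set vs \<Longrightarrow> \<sigma> (PV x k) = S k x"
  shows "sem M I \<sigma> (app p vs ks) \<longleftrightarrow> concat (map (\<lambda>k. map (S k) vs) ks) \<in> I p"
proof -
  have "map (\<lambda>k. map (\<lambda>x. \<sigma> (PV x k)) vs) ks = map (\<lambda>k. map (S k) vs) ks"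
    using assms by simp
  then show ?thesis by (simp only: sem_app)
qed

lemma holds_at_app: "holds_at M I s (app p vs [0]) \<longleftrightarrow> map s vs \<in> I p"
  by (simp add: holds_at_def sem_app)

lemma fv_app: "fv (app p vs ks) = (\<Union>k \<in> set ks. set (copies vs k))"
  by (auto simp: app_def)


section \<open>Using clauses\<close>

text \<open>Values of variables that a clause about the program does not mention are irrelevant, but
  they must respect sorts; the truth value \<open>tt\<close> belongs to both sorts.\<close>

primrec clause_val ::
    "('f, 'r, 'e) struct \<Rightarrow> pvar list \<Rightarrow> (nat \<Rightarrow> 'e state) \<Rightarrow> var \<Rightarrow> 'e" where
  "clause_val M vs S (PV x k) = (if x \<in> set vs then S k x else tt M)"
| "clause_val M vs S (LV s n) = tt M"

lemma tt_in_carrier: "tt M \<in> carrier_of M s"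
  by (cases s) auto

lemma well_sorted_clause_val:
  assumes "\<And>k. S k \<in> states M D"
  shows "well_sorted M (clause_val M (vars D) S)"
  unfolding well_sorted_def
proof
  fix x
  show "clause_val M (vars D) S x \<in> carrier_of M (var_sort x)"
    using assms tt_in_carrier by (cases x) (auto simp: states_def PiE_iff)
qed

lemma clause_trueD:
  assumes "clause_true M I (Clause b [] h)" "\<And>k. S k \<in> states M D"
    "sem M I (clause_val M (vars D) S) b"
  shows "sem M I (clause_val M (vars D) S) h"
proof -
  have "well_sorted M (clause_val M (vars D) S)"
    using assms(2) by (rule well_sorted_clause_val)
  with assms(1,3) obtain \<tau> where "\<forall>y. \<tau> y = clause_val M (vars D) S y" "sem M I \<tau> h"
    by auto
  moreover from this have "\<tau> = clause_val M (vars D) S" by blast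
  ultimately show ?thesis by simp
qed

text \<open>Every copy is read off the single state \<open>s\<close>, because the bodies of
  existential clauses mention copy 0 only. The witness \<open>\<tau>\<close> supplies new values for
  the variables in \<open>xs\<close>.\<close>

lemma clause_true_exD:
  assumes "clause_true M I (Clause b xs h)" "s \<in> states M D"
    "sem M I (clause_val M (vars D) (\<lambda>_. s)) b"
  obtains \<tau> where "well_sorted M \<tau>" "\<And>x k. x \<in> set (vars D) \<Longrightarrow> PV x k \<notin> set xs \<Longrightarrow> \<tau> (PV x k) = s x"
    "sem M I \<tau> h"
  using assms well_sorted_clause_val[of "\<lambda>_. s" M D] by force

declare clause_true.simps(1) [simp del]

text \<open>Turns the witness of an existential clause into a state. The restriction is there
  because states are extensional functions on the program variables.\<close>

lemma state_of_valuation: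
  assumes "well_sorted M \<tau>"
  shows "restrict (\<lambda>x. \<tau> (PV x k)) (set (vars D)) \<in> states M D"
proof -
  have "\<tau> (PV x k) \<in> carrier_of M (pvar_sort x)" for x
    using assms by (metis well_sorted_def var_sort.simps(1))
  then show ?thesis by (auto simp: states_def)
qed

lemma sem_clause_val_app:
  "sem M I (clause_val M vs S) (app p vs ks) \<longleftrightarrow> concat (map (\<lambda>k. map (S k) vs) ks) \<in> I p"
  by (rule sem_app_agree) simp

lemma sem_clause_val_shift:
  "over vs a \<Longrightarrow> sem M I (clause_val M vs S) (shift k a) \<longleftrightarrow> holds_at M I (S k) a"
  by (rule sem_shift_holds_at) auto

lemma sem_clause_val:
  "over vs a \<Longrightarrow> sem M I (clause_val M vs S) a \<longleftrightarrow> holds_at M I (S 0) a"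
  by (rule sem_holds_at) auto

lemma clause_init_trueD:
  assumes "clause_true M I (Clause (init D) [] h)" "over (vars D) (init D)"
    "s \<in> states M D" "holds_at M I s (init D)"
  shows "sem M I (clause_val M (vars D) (\<lambda>_. s)) h"
  using assms by (intro clause_trueD[OF assms(1)]) (auto simp: sem_clause_val)

lemma sem_clause_val_step_shift:
  "over2 vs a \<Longrightarrow> sem M I (clause_val M vs S) (shift k a) \<longleftrightarrow> holds_step M I (S k) (S (Suc k)) a"
  by (rule sem_shift_holds_step) auto

lemma sem_clause_val_step:
  "over2 vs a \<Longrightarrow> sem M I (clause_val M vs S) a \<longleftrightarrow> holds_step M I (S 0) (S (Suc 0)) a"
  by (rule sem_holds_step) auto


section \<open>Path formulas\<close>

lemma state_is_assertion_sat:
  "state_is_assertion \<phi> a \<Longrightarrow> sat_state M I D s \<phi> \<longleftrightarrow> holds_at M I s a"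
  by (induction rule: state_is_assertion.induct) (auto simp: holds_at_def)

lemma path_is_assertion_sat:
  "path_is_assertion \<psi> a \<Longrightarrow> sat_path M I D \<pi> \<psi> \<longleftrightarrow> holds_at M I (\<pi> 0) a"
  by (induction rule: path_is_assertion.induct) (auto simp: holds_at_def state_is_assertion_sat)

lemma state_is_assertion_quant_free: "state_is_assertion \<phi> a \<Longrightarrow> quant_free_state \<phi>"
  by (induction rule: state_is_assertion.induct) auto

lemma path_is_assertion_quant_free: "path_is_assertion \<psi> a \<Longrightarrow> quant_free \<psi>"
  by (induction rule: path_is_assertion.induct) (auto simp: state_is_assertion_quant_free)

lemma state_is_assertion_fv:
  "state_is_assertion \<phi> a \<Longrightarrow> fv a = (\<Union>b \<in> sform_asserts \<phi>. fv b)"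
  by (induction rule: state_is_assertion.induct) auto

lemma path_is_assertion_fv:
  "path_is_assertion \<psi> a \<Longrightarrow> fv a = (\<Union>b \<in> pform_asserts \<psi>. fv b)"
  by (induction rule: path_is_assertion.induct) (auto simp: state_is_assertion_fv)

text \<open>Satisfaction consults the program only at path quantifiers. Without them the program may
  be exchanged, and only the values of the mentioned variables count. This allows passing between
  \<open>D\<close> and its extension by a Boolean variable.\<close>

lemma
  shows sat_state_quant_free_cong:
    "quant_free_state \<phi> \<Longrightarrow> \<forall>a \<in> sform_asserts \<phi>. over vs a \<Longrightarrow> (\<And>x. x \<in> set vs \<Longrightarrow> s x = s' x) \<Longrightarrow>
      sat_state M I D s \<phi> \<longleftrightarrow> sat_state M I D' s' \<phi>"
    and sat_path_quant_free_cong: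
    "quant_free \<psi> \<Longrightarrow> \<forall>a \<in> pform_asserts \<psi>. over vs a \<Longrightarrow>
      (\<And>i x. x \<in> set vs \<Longrightarrow> \<pi> i x = \<pi>' i x) \<Longrightarrow>
      sat_path M I D \<pi> \<psi> \<longleftrightarrow> sat_path M I D' \<pi>' \<psi>"
proof (induction \<phi> and \<psi> arbitrary: s s' and \<pi> \<pi>')
  case (Asrt a)
  then show ?case using holds_at_cong[of a vs s s' M I] by simp
next
  case (SAnd a b)
  then show ?case using SAnd.IH(1)[of s s'] SAnd.IH(2)[of s s'] by simp
next
  case (SOr a b)
  then show ?case using SOr.IH(1)[of s s'] SOr.IH(2)[of s s'] by simp
next
  case (PState a)
  then show ?case using PState.IH[of "\<pi> 0" "\<pi>' 0"] by simp
next
  case (PAnd a b)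
  then show ?case using PAnd.IH(1)[of \<pi> \<pi>'] PAnd.IH(2)[of \<pi> \<pi>'] by simp
next
  case (POr a b)
  then show ?case using POr.IH(1)[of \<pi> \<pi>'] POr.IH(2)[of \<pi> \<pi>'] by simp
next
  case (PX a)
  then show ?case using PX.IH[of "\<lambda>i. \<pi> (Suc i)" "\<lambda>i. \<pi>' (Suc i)"] by simp
next
  case (PG a)
  then show ?case using PG.IH[of "\<lambda>i. \<pi> (n + i)" "\<lambda>i. \<pi>' (n + i)" for n] by simp
next
  case (PU a b)
  then show ?case
    using PU.IH(1)[of "\<lambda>i. \<pi> (n + i)" "\<lambda>i. \<pi>' (n + i)" for n]
      PU.IH(2)[of "\<lambda>i. \<pi> (n + i)" "\<lambda>i. \<pi>' (n + i)" for n] by simp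
qed simp

text \<open>The second conjunct reflects that a genuine replacement needs an occurrence of the
  replaced formula, whose assertions then inherit the scope of the whole formula.\<close>

lemma
  shows replace_state_asserts: "replace_state \<alpha> \<gamma> \<phi> \<phi>' \<Longrightarrow>
      sform_asserts \<phi>' \<subseteq> sform_asserts \<phi> \<union> sform_asserts \<gamma> \<and>
      (\<phi>' = \<phi> \<or> sform_asserts \<alpha> \<subseteq> sform_asserts \<phi>)"
    and replace_state_in_path_asserts: "replace_state_in_path \<alpha> \<gamma> \<psi> \<psi>' \<Longrightarrow>
      pform_asserts \<psi>' \<subseteq> pform_asserts \<psi> \<union> sform_asserts \<gamma> \<and>
      (\<psi>' = \<psi> \<or> sform_asserts \<alpha> \<subseteq> pform_asserts \<psi>)"
  by (induction rule: replace_state_replace_state_in_path.inducts) auto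

lemma replace_path_asserts: "replace_path \<rho> \<gamma> \<psi> \<psi>' \<Longrightarrow>
    pform_asserts \<psi>' \<subseteq> pform_asserts \<psi> \<union> pform_asserts \<gamma> \<and>
    (\<psi>' = \<psi> \<or> pform_asserts \<rho> \<subseteq> pform_asserts \<psi>)"
  by (induction rule: replace_path.induct) auto

lemma replace_path_quant_free:
  "replace_path \<rho> \<gamma> \<psi> \<psi>' \<Longrightarrow> quant_free \<psi> \<Longrightarrow> quant_free \<gamma> \<Longrightarrow> quant_free \<psi>'"
  by (induction rule: replace_path.induct) auto

text \<open>The path version is limited to paths inside \<open>states M D\<close>, because the
  hypothesis on \<open>\<gamma>\<close> speaks about those states only; the path quantifiers range
  over such paths.\<close>

lemma
  assumes \<gamma>: "\<And>s. s \<in> states M D \<Longrightarrow> sat_state M I D s \<gamma> \<Longrightarrow> sat_state M I D s \<alpha>"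
  shows replace_state_mono: "replace_state \<alpha> \<gamma> \<phi> \<phi>' \<Longrightarrow>
      \<forall>s \<in> states M D. sat_state M I D s \<phi>' \<longrightarrow> sat_state M I D s \<phi>"
    and replace_state_in_path_mono: "replace_state_in_path \<alpha> \<gamma> \<psi> \<psi>' \<Longrightarrow>
      \<forall>\<pi>. range \<pi> \<subseteq> states M D \<longrightarrow> sat_path M I D \<pi> \<psi>' \<longrightarrow> sat_path M I D \<pi> \<psi>"
proof (induction rule: replace_state_replace_state_in_path.inducts)
  case (5 \<psi> \<psi>' q)
  have "sat_path M I D \<pi> \<psi>' \<Longrightarrow> sat_path M I D \<pi> \<psi>" if "is_path M I D \<pi>" for \<pi>
    using 5 that by (auto simp: is_path_def)
  then show ?case by (cases q) (auto simp: fair_path_def)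
next
  case (9 a a')
  show ?case
  proof (intro allI impI)
    fix \<pi> assume "range \<pi> \<subseteq> states M D" "sat_path M I D \<pi> (PX a')"
    then show "sat_path M I D \<pi> (PX a)" using 9(2)[rule_format, of "\<lambda>i. \<pi> (Suc i)"] by auto
  qed
next
  case (10 a a')
  show ?case
  proof (intro allI impI)
    fix \<pi> assume *: "range \<pi> \<subseteq> states M D" and "sat_path M I D \<pi> (PG a')"
    moreover have "range (\<lambda>i. \<pi> (n + i)) \<subseteq> states M D" for n using * by auto
    ultimately show "sat_path M I D \<pi> (PG a)" using 10(2) by simp
  qed
next
  case (11 a a' b b')
  show ?case
  proof (intro allI impI)
    fix \<pi> assume *: "range \<pi> \<subseteq> states M D" and "sat_path M I D \<pi> (PU a' b')"
    moreover have "range (\<lambda>i. \<pi> (n + i)) \<subseteq> states M D" for n using * by auto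
    ultimately show "sat_path M I D \<pi> (PU a b)"
      using 11(2,4) by (simp, meson)
  qed
qed (auto simp: \<gamma>)


section \<open>Elimination of temporal operators\<close>

lemma infinite_nat_iff: "infinite {i::nat. P i} \<longleftrightarrow> (\<forall>n. \<exists>i \<ge> n. P i)"
  by (simp add: infinite_nat_iff_unbounded_le)

text \<open>The recursion alone is also solved by the labelling that is false everywhere. The
  fairness condition forbids a label that stays false while \<open>c\<close> stays true, which
  leaves only the greatest solution.\<close>

lemma globally_labelling:
  fixes x c :: "nat \<Rightarrow> bool"
  shows "(\<forall>i. x i \<longleftrightarrow> c i \<and> x (Suc i)) \<and> infinite {i. x i \<or> \<not> c i} \<longleftrightarrow>
    (\<forall>i. x i \<longleftrightarrow> (\<forall>n. c (i + n)))" (is "?L \<longleftrightarrow> ?R")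
proof
  assume ?L
  then have L: "\<And>i. x i \<longleftrightarrow> c i \<and> x (Suc i)" and inf: "\<And>n. \<exists>i \<ge> n. x i \<or> \<not> c i"
    unfolding infinite_nat_iff by blast+
  have pos: "x (i + n)" if "x i" for i n
  proof (induction n)
    case (Suc n)
    then show ?case by (metis L add_Suc_right)
  qed (use that in simp)
  \<comment> \<open>Where \<open>c\<close> holds forever, a false label remains false, and the
    fairness condition is violated from \<open>i\<close> on.\<close>
  have neg: "\<not> x (i + n)" if "\<not> x i" "\<forall>n. c (i + n)" for i n
  proof (induction n)
    case (Suc n)
    then show ?case using L that(2) by (metis add_Suc_right)
  qed (use that in simp)
  show ?R
  proof (intro allI iffI)
    fix i n assume "x i"
    from pos[OF this] L[of "i + n"] show "c (i + n)" by blast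
  next
    fix i assume c: "\<forall>n. c (i + n)"
    obtain j where "j \<ge> i" "x j \<or> \<not> c j" using inf by blast
    then show "x i" using neg[OF _ c, of "j - i"] c[rule_format, of "j - i"] by auto
  qed
next
  assume R: ?R
  have "x i \<longleftrightarrow> c i \<and> x (Suc i)" for i
  proof -
    have "(\<forall>n. c (i + n)) \<longleftrightarrow> c i \<and> (\<forall>n. c (Suc i + n))"
      by (metis add.right_neutral add_Suc add_Suc_right not0_implies_Suc)
    with R show ?thesis by blast
  qed
  moreover have "\<exists>i \<ge> n. x i \<or> \<not> c i" for n
  proof (rule ccontr)
    assume "\<nexists>i. n \<le> i \<and> (x i \<or> \<not> c i)"
    then have "\<forall>m. c (n + m)" "\<not> x n" by auto
    with R show False by blast
  qed
  ultimately show ?L unfolding infinite_nat_iff by blast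
qed

text \<open>Dual to the previous lemma: the recursion alone allows a label to stay true while
  \<open>d\<close> is postponed forever. Fairness forbids this and leaves only the least
  solution.\<close>

lemma until_labelling:
  fixes x c d :: "nat \<Rightarrow> bool"
  shows "(\<forall>i. x i \<longleftrightarrow> d i \<or> c i \<and> x (Suc i)) \<and> infinite {i. \<not> x i \<or> d i} \<longleftrightarrow>
    (\<forall>i. x i \<longleftrightarrow> (\<exists>n. d (i + n) \<and> (\<forall>m<n. c (i + m))))" (is "?L \<longleftrightarrow> ?R")
proof
  assume ?L
  then have L: "\<And>i. x i \<longleftrightarrow> d i \<or> c i \<and> x (Suc i)" and inf: "\<And>n. \<exists>i \<ge> n. \<not> x i \<or> d i"
    unfolding infinite_nat_iff by blast+
  have pos: "x i" if "d (i + n)" "\<forall>m<n. c (i + m)" for i n using that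
  proof (induction n arbitrary: i)
    case (Suc n)
    have "x (Suc i)" using Suc.prems by (intro Suc.IH) auto
    moreover have "c i" using Suc.prems(2) by (metis add.right_neutral zero_less_Suc)
    ultimately show ?case using L by blast
  next
    case (0 i)
    then show ?case using L[of i] by simp
  qed
  \<comment> \<open>While \<open>d\<close> is absent, a true label can only be justified by the
    second disjunct, so both \<open>c\<close> and the label persist.\<close>
  have neg: "x (i + n) \<and> c (i + n)" if "x i" "\<forall>m\<le>n. \<not> d (i + m)" for i n using that
  proof (induction n)
    case (Suc n)
    then have "x (i + n)" "c (i + n)" "\<not> d (i + n)" "\<not> d (i + Suc n)" by auto
    then show ?case using L[of "i + n"] L[of "i + Suc n"] by simp
  next
    case 0
    then show ?case using L[of i] by simp
  qed
  show ?R
  proof (intro allI iffI)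
    fix i assume x: "x i"
    have "\<exists>n. d (i + n)"
    proof (rule ccontr)
      assume no: "\<nexists>n. d (i + n)"
      obtain j where "j \<ge> i" "\<not> x j \<or> d j" using inf by blast
      then show False using neg[OF x, of "j - i"] no by (metis le_add_diff_inverse)
    qed
    \<comment> \<open>The first occurrence of \<open>d\<close> is taken, since \<open>neg\<close>
      yields \<open>c\<close> only at positions before it.\<close>
    then obtain n where n: "d (i + n)" "\<forall>m<n. \<not> d (i + m)"
      by (auto simp: exists_least_iff[of "\<lambda>n. d (i + n)"])
    have "c (i + m)" if "m < n" for m
      using neg[OF x, of m] n(2) that by simp
    with n show "\<exists>n. d (i + n) \<and> (\<forall>m<n. c (i + m))" by blast
  qed (use pos in blast)
next
  assume R: ?R
  have "x i \<longleftrightarrow> d i \<or> c i \<and> x (Suc i)" for i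
  proof
    assume "x i"
    then obtain n where n: "d (i + n)" "\<forall>m<n. c (i + m)" using R by blast
    show "d i \<or> c i \<and> x (Suc i)"
    proof (cases n)
      case (Suc k)
      have "d (Suc i + k)" "\<forall>m<k. c (Suc i + m)" using n Suc by auto
      then have "x (Suc i)" using R by blast
      moreover have "c i" using n(2) Suc by (metis add.right_neutral zero_less_Suc)
      ultimately show ?thesis by blast
    qed (use n in simp)
  next
    assume "d i \<or> c i \<and> x (Suc i)"
    then show "x i"
    proof
      assume "d i"
      then have "d (i + 0) \<and> (\<forall>m<0. c (i + m))" by simp
      then show ?thesis using R by blast
    next
      assume *: "c i \<and> x (Suc i)"
      then obtain n where n: "d (Suc i + n)" "\<forall>m<n. c (Suc i + m)" using R by blast
      have "d (i + Suc n) \<and> (\<forall>m<Suc n. c (i + m))"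
        using n * by (auto simp: less_Suc_eq_0_disj)
      then show ?thesis using R by blast
    qed
  qed
  moreover have "\<exists>i \<ge> n. \<not> x i \<or> d i" for n
  proof (rule ccontr)
    assume "\<nexists>i. n \<le> i \<and> (\<not> x i \<or> d i)"
    then have "\<forall>m. \<not> d (n + m)" "x n" by auto
    with R show False by blast
  qed
  ultimately show ?L unfolding infinite_nat_iff by blast
qed

section \<open>Correctness of the label of a temporal formula\<close>

definition labels ::
    "('f, 'r, 'e) struct \<Rightarrow> 'e interp \<Rightarrow> ('f, 'r) prog \<Rightarrow> pvar \<Rightarrow> ('f, 'r) pform \<Rightarrow>
      (nat \<Rightarrow> 'e state) \<Rightarrow> bool" where
  "labels M I D x \<rho> \<pi> \<longleftrightarrow> (\<forall>i. \<pi> i x = tt M \<longleftrightarrow> sat_path M I D (\<lambda>j. \<pi> (i + j)) \<rho>)"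

lemma holds_at_bvar: "holds_at M I s (bvar x 0) \<longleftrightarrow> s x = tt M"
  by (simp add: holds_at_def)

text \<open>For \<open>PX\<close> the conjunct determines the label outright; for \<open>PG\<close>
  and \<open>PU\<close> the two labelling lemmas apply. Read from left to right this serves
  \<open>QEf\<close>, where a fair path of the extended program is given; from right to left it
  serves \<open>QAf\<close>, where one has to be built.\<close>

lemma temporal_labels:
  assumes "temporal x \<rho> \<delta> Js" "\<forall>a \<in> pform_asserts \<rho>. over vs a"
  shows "(\<forall>i. holds_step M I (\<pi> i) (\<pi> (Suc i)) \<delta>) \<and> (\<forall>j \<in> set Js. infinite {i. holds_at M I (\<pi> i) j})
    \<longleftrightarrow> labels M I D x \<rho> \<pi>"
  using assms
proof cases
  case (temporal_X \<psi> c)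
  have "over vs c" using path_is_assertion_fv[OF temporal_X(4)] assms(2) temporal_X(1) by auto
  note holds_step_shift_1[OF this, of M I]
  then show ?thesis
    by (auto simp: temporal_X labels_def path_is_assertion_sat[OF temporal_X(4)] holds_step_def)
next
  case (temporal_G \<psi> c)
  have "over vs c" using path_is_assertion_fv[OF temporal_G(4)] assms(2) temporal_G(1) by auto
  note [simp] = holds_step_current[OF this, of M I, unfolded holds_step_def]
  have "labels M I D x \<rho> \<pi> \<longleftrightarrow> (\<forall>i. \<pi> i x = tt M \<longleftrightarrow> (\<forall>n. holds_at M I (\<pi> (i + n)) c))"
    by (simp add: temporal_G labels_def path_is_assertion_sat[OF temporal_G(4)])
  also have "\<dots> \<longleftrightarrow> (\<forall>i. \<pi> i x = tt M \<longleftrightarrow> holds_at M I (\<pi> i) c \<and> \<pi> (Suc i) x = tt M) \<and>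
      infinite {i. \<pi> i x = tt M \<or> \<not> holds_at M I (\<pi> i) c}"
    by (rule globally_labelling[symmetric])
  also have "\<dots> \<longleftrightarrow> (\<forall>i. holds_step M I (\<pi> i) (\<pi> (Suc i)) \<delta>) \<and>
      (\<forall>j \<in> set Js. infinite {i. holds_at M I (\<pi> i) j})"
    by (auto simp: temporal_G holds_step_def holds_at_def)
  finally show ?thesis by blast
next
  case (temporal_U \<psi>\<^sub>1 c\<^sub>1 \<psi>\<^sub>2 c\<^sub>2)
  have "over vs c\<^sub>1" "over vs c\<^sub>2"
    using path_is_assertion_fv[OF temporal_U(4)] path_is_assertion_fv[OF temporal_U(5)]
      assms(2) temporal_U(1) by auto
  note [simp] = this[THEN holds_step_current, of M I, unfolded holds_step_def]
  have "labels M I D x \<rho> \<pi> \<longleftrightarrow>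
      (\<forall>i. \<pi> i x = tt M \<longleftrightarrow>
        (\<exists>n. holds_at M I (\<pi> (i + n)) c\<^sub>2 \<and> (\<forall>m<n. holds_at M I (\<pi> (i + m)) c\<^sub>1)))"
    by (simp add: temporal_U labels_def path_is_assertion_sat[OF temporal_U(4)]
        path_is_assertion_sat[OF temporal_U(5)])
  also have "\<dots> \<longleftrightarrow>
      (\<forall>i. \<pi> i x = tt M \<longleftrightarrow> holds_at M I (\<pi> i) c\<^sub>2 \<or> holds_at M I (\<pi> i) c\<^sub>1 \<and> \<pi> (Suc i) x = tt M) \<and>
      infinite {i. \<not> \<pi> i x = tt M \<or> holds_at M I (\<pi> i) c\<^sub>2}"
    by (rule until_labelling[symmetric])
  also have "\<dots> \<longleftrightarrow> (\<forall>i. holds_step M I (\<pi> i) (\<pi> (Suc i)) \<delta>) \<and>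
      (\<forall>j \<in> set Js. infinite {i. holds_at M I (\<pi> i) j})"
    by (auto simp: temporal_U holds_step_def holds_at_def)
  finally show ?thesis by blast
qed

lemma sat_path_PX_Suc: "sat_path M I D (\<lambda>j. \<pi> (i + j)) (PX a) \<longleftrightarrow> sat_path M I D (\<lambda>j. \<pi> (Suc i + j)) a"
  by simp

lemma temporal_scope:
  assumes "temporal x \<rho> \<delta> Js" "\<forall>a \<in> pform_asserts \<rho>. over vs a"
  shows "over2 (vs @ [x]) \<delta>" "\<forall>j \<in> set Js. over (vs @ [x]) j" "quant_free \<rho>"
proof -
  have "over2 (vs @ [x]) \<delta> \<and> (\<forall>j \<in> set Js. over (vs @ [x]) j)"
    using assms
  proof cases
    case (temporal_X \<psi> c)
    have "over vs c" using path_is_assertion_fv[OF temporal_X(4)] assms(2) temporal_X(1) by auto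
    then have "fv (shift 1 c) \<subseteq> set (copies vs 1)"
      using fv_shift[of 1 c] by (force simp: in_copies)
    then show ?thesis by (auto simp: temporal_X copies_def)
  next
    case (temporal_G \<psi> c)
    have "over vs c" using path_is_assertion_fv[OF temporal_G(4)] assms(2) temporal_G(1) by auto
    then show ?thesis by (auto simp: temporal_G copies_def)
  next
    case (temporal_U \<psi>\<^sub>1 c\<^sub>1 \<psi>\<^sub>2 c\<^sub>2)
    have "over vs c\<^sub>1" "over vs c\<^sub>2"
      using path_is_assertion_fv[OF temporal_U(4)] path_is_assertion_fv[OF temporal_U(5)]
        assms(2) temporal_U(1) by auto
    then show ?thesis by (auto simp: temporal_U copies_def)
  qed
  then show "over2 (vs @ [x]) \<delta>" "\<forall>j \<in> set Js. over (vs @ [x]) j" by blast+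
  show "quant_free \<rho>" using assms(1) by cases (auto simp: path_is_assertion_quant_free)
qed

text \<open>The claim ranges over all suffixes of one path, because the temporal operators around a
  replaced occurrence move along that path. Since \<open>\<psi>\<close> has no path quantifiers, no
  other path has to be labelled.\<close>

lemma replace_path_labels:
  assumes "labels M I D x \<rho> \<pi>"
  shows "replace_path \<rho> (PState (Asrt (bvar x 0))) \<psi> \<psi>' \<Longrightarrow> quant_free \<psi> \<Longrightarrow>
    sat_path M I D (\<lambda>j. \<pi> (i + j)) \<psi>' \<longleftrightarrow> sat_path M I D (\<lambda>j. \<pi> (i + j)) \<psi>"
proof (induction arbitrary: i rule: replace_path.induct)
  case 1
  then show ?case using assms by (simp add: labels_def holds_at_bvar)
next
  case (5 a a')
  then show ?case unfolding sat_path_PX_Suc by (simp only: quant_free.simps)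
next
  case (6 a a')
  then show ?case using 6(2)[of "i + n" for n] by (simp add: add.assoc)
next
  case (7 a a' b b')
  then show ?case using 7(3,4)[of "i + n" for n] by (simp add: add.assoc)
qed auto

section \<open>The program extended by a Boolean variable\<close>

definition scoped :: "('f, 'r) prog \<Rightarrow> bool" where
  "scoped D \<longleftrightarrow> over (vars D) (init D) \<and> over2 (vars D) (nxt D) \<and> (\<forall>j \<in> set (fair D). over (vars D) j)"

lemma over_append: "over vs a \<Longrightarrow> over (vs @ [x]) a"
  by (auto simp: copies_def)

text \<open>The initial condition is a parameter since it is kept for \<open>QAf\<close> but becomes
  an application of \<open>aux\<close> for \<open>QEf\<close>.\<close>

definition extend ::
    "('f, 'r) prog \<Rightarrow> pvar \<Rightarrow> ('f, 'r) fm \<Rightarrow> ('f, 'r) fm \<Rightarrow> ('f, 'r) fm list \<Rightarrow> ('f, 'r) prog" where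
  "extend D x b \<delta> Js = \<lparr>vars = vars D @ [x], init = b, nxt = Conj (nxt D) \<delta>, fair = fair D @ Js\<rparr>"

lemma extend_simps [simp]:
  "vars (extend D x b \<delta> Js) = vars D @ [x]" "init (extend D x b \<delta> Js) = b"
  "nxt (extend D x b \<delta> Js) = Conj (nxt D) \<delta>" "fair (extend D x b \<delta> Js) = fair D @ Js"
  by (simp_all add: extend_def)

lemma holds_step_Conj:
  "holds_step M I s s' (Conj a b) \<longleftrightarrow> holds_step M I s s' a \<and> holds_step M I s s' b"
  by (simp add: holds_step_def)

text \<open>The two paths are tied together only by agreement on the old variables, so this covers
  lifting a path of \<open>D\<close> as well as projecting a path of the extension. The old
  conditions transfer by agreement; the new ones amount to \<open>labels\<close>.\<close>

lemma fair_path_extend: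
  assumes "scoped D" "temporal x \<rho> \<delta> Js" "\<forall>a \<in> pform_asserts \<rho>. over (vars D) a"
    and agree: "\<And>i y. y \<in> set (vars D) \<Longrightarrow> \<pi>' i y = \<pi> i y"
    and states: "\<And>i. \<pi>' i \<in> states M (extend D x b \<delta> Js)" "\<And>i. \<pi> i \<in> states M D"
  shows "fair_path M I (extend D x b \<delta> Js) \<pi>' \<longleftrightarrow> fair_path M I D \<pi> \<and> labels M I D x \<rho> \<pi>'"
proof -
  have "holds_step M I (\<pi>' i) (\<pi>' (Suc i)) (nxt D) \<longleftrightarrow> holds_step M I (\<pi> i) (\<pi> (Suc i)) (nxt D)" for i
    using assms(1) agree by (intro holds_step_cong[where vs = "vars D"]) (auto simp: scoped_def)
  moreover have "holds_at M I (\<pi>' i) j \<longleftrightarrow> holds_at M I (\<pi> i) j" if "j \<in> set (fair D)" for i j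
    using assms(1) agree that by (intro holds_at_cong[where vs = "vars D"]) (auto simp: scoped_def)
  then have "(\<forall>j \<in> set (fair D). infinite {i. holds_at M I (\<pi>' i) j}) \<longleftrightarrow>
      (\<forall>j \<in> set (fair D). infinite {i. holds_at M I (\<pi> i) j})"
    by simp
  ultimately show ?thesis
    unfolding temporal_labels[OF assms(2,3), of M I \<pi>' D, symmetric]
    unfolding fair_path_def is_path_def extend_simps set_append ball_Un step_iff holds_step_Conj
    using states by blast
qed

lemma replace_path_extend_sat:
  assumes "quant_free \<psi>" "\<forall>a \<in> pform_asserts \<psi>. over (vars D) a"
    and replace: "replace_path \<rho> (PState (Asrt (bvar x 0))) \<psi> \<psi>'"
    and "labels M I D x \<rho> \<pi>'"
    and agree: "\<And>i y. y \<in> set (vars D) \<Longrightarrow> \<pi>' i y = \<pi> i y"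
  shows "sat_path M I (extend D x b \<delta> Js) \<pi>' \<psi>' \<longleftrightarrow> sat_path M I D \<pi> \<psi>"
proof -
  have "pform_asserts \<psi>' \<subseteq> insert (bvar x 0) (pform_asserts \<psi>)" "quant_free \<psi>'"
    using replace_path_asserts[OF replace] replace_path_quant_free[OF replace] assms(1) by auto
  moreover have "over (vars D @ [x]) (bvar x 0)" by (simp add: copies_def)
  ultimately have "quant_free \<psi>'" "\<forall>a \<in> pform_asserts \<psi>'. over (vars D @ [x]) a"
    using assms(2) over_append by blast+
  then have "sat_path M I (extend D x b \<delta> Js) \<pi>' \<psi>' \<longleftrightarrow> sat_path M I D \<pi>' \<psi>'"
    by (rule sat_path_quant_free_cong) simp
  also have "\<dots> \<longleftrightarrow> sat_path M I D \<pi>' \<psi>"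
    using replace_path_labels[OF assms(4) replace assms(1), of 0] by simp
  also have "\<dots> \<longleftrightarrow> sat_path M I D \<pi> \<psi>"
    using assms(1,2) agree by (rule sat_path_quant_free_cong)
  finally show ?thesis .
qed

lemma states_extend_iff:
  "s \<in> states M (extend D x b \<delta> Js) \<longleftrightarrow>
    s \<in> (\<Pi>\<^sub>E y \<in> insert x (set (vars D)). carrier_of M (pvar_sort y))"
  by (simp add: states_def)

lemma extend_scope:
  assumes "scoped D" "temporal x \<rho> \<delta> Js"
    and replace: "replace_path \<rho> (PState (Asrt (bvar x 0))) \<psi> \<psi>'" "\<psi>' \<noteq> \<psi>"
    and \<psi>: "\<forall>a \<in> pform_asserts \<psi>. over (vars D) a" and b: "over (vars D @ [x]) b"
  shows "scoped (extend D x b \<delta> Js)"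
    and "\<forall>a \<in> pform_asserts \<psi>'. over (vars (extend D x b \<delta> Js)) a"
proof -
  note asserts = replace_path_asserts[OF replace(1)]
  then have "\<forall>a \<in> pform_asserts \<rho>. over (vars D) a" using replace(2) \<psi> by blast
  note scope = temporal_scope[OF assms(2) this]
  have "over2 (vars D @ [x]) (nxt D)" "\<forall>j \<in> set (fair D). over (vars D @ [x]) j"
    using assms(1) by (auto simp: scoped_def copies_def)
  with scope b show "scoped (extend D x b \<delta> Js)" by (auto simp: scoped_def)
  have "over (vars D @ [x]) (bvar x 0)" by (simp add: copies_def)
  then show "\<forall>a \<in> pform_asserts \<psi>'. over (vars (extend D x b \<delta> Js)) a"
    using asserts \<psi> over_append by fastforce
qed

text \<open>Each fair path of \<open>D\<close> is lifted to the extension by writing the truth of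
  \<open>\<rho>\<close> into \<open>x\<close> at every position; the assumption about the extension
  is then applied to the lifted path.\<close>

lemma temporal_Af_sound:
  assumes "tt M \<noteq> ff M" "scoped D" "fresh_bool x D" "temporal x \<rho> \<delta> Js"
    and \<psi>: "quant_free \<psi>" "\<forall>a \<in> pform_asserts \<psi>. over (vars D) a"
    and replace: "replace_path \<rho> (PState (Asrt (bvar x 0))) \<psi> \<psi>'" "\<psi>' \<noteq> \<psi>"
    and models: "models_in M I (extend D x (init D) \<delta> Js) (Quant QAf \<psi>')"
  shows "models_in M I D (Quant QAf \<psi>)"
  unfolding models_in_def sat_state.simps quant.case
proof (intro ballI allI impI)
  fix s \<pi> assume s: "holds_at M I s (init D)" and \<pi>: "fair_path M I D \<pi> \<and> \<pi> 0 = s"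
  let ?D = "extend D x (init D) \<delta> Js"
  have \<rho>: "\<forall>a \<in> pform_asserts \<rho>. over (vars D) a"
    using replace_path_asserts[OF replace(1)] replace(2) \<psi>(2) by blast
  note q = temporal_scope(3)[OF assms(4) \<rho>]
  have x: "pvar_sort x = Boolean" "x \<notin> set (vars D)" using assms(3) by (auto simp: fresh_bool_def)
  define \<pi>' where "\<pi>' i = (\<pi> i)(x := if sat_path M I D (\<lambda>j. \<pi> (i + j)) \<rho> then tt M else ff M)" for i
  have agree: "\<pi>' i y = \<pi> i y" if "y \<in> set (vars D)" for i y
    using that x(2) by (auto simp: \<pi>'_def)
  have in_states: "\<pi> i \<in> states M D" for i using \<pi> by (auto simp: fair_path_def is_path_def)
  have in_states': "\<pi>' i \<in> states M ?D" for i
    unfolding states_extend_iff \<pi>'_def using in_states[of i] x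
    by (auto simp: states_def intro!: PiE_fun_upd)
  have "sat_path M I D (\<lambda>j. \<pi>' (i + j)) \<rho> \<longleftrightarrow> sat_path M I D (\<lambda>j. \<pi> (i + j)) \<rho>" for i
    using q \<rho> agree by (rule sat_path_quant_free_cong)
  \<comment> \<open>A position where \<open>\<rho>\<close> fails carries \<open>ff M\<close>, which
    counts as a false label because the truth values are distinct.\<close>
  then have labels: "labels M I D x \<rho> \<pi>'"
    using assms(1) by (auto simp: labels_def \<pi>'_def)
  then have "fair_path M I ?D \<pi>'"
    using \<pi> by (simp add: fair_path_extend[OF assms(2,4) \<rho> agree in_states' in_states])
  moreover have "holds_at M I (\<pi>' 0) (init D)"
    using s \<pi> holds_at_cong[of "init D" "vars D" "\<pi>' 0" "\<pi> 0"] agree assms(2)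
    by (auto simp: scoped_def)
  ultimately have "sat_path M I ?D \<pi>' \<psi>'"
    using models in_states' by (auto simp: models_in_def)
  then show "sat_path M I D \<pi> \<psi>"
    using replace_path_extend_sat[OF \<psi> replace(1) labels agree] by blast
qed

text \<open>The clause for \<open>aux\<close> chooses a value of \<open>x\<close> in the initial
  state. The extension has a satisfying fair path from there, and forgetting \<open>x\<close> along
  it gives the path of \<open>D\<close>.\<close>

lemma temporal_Ef_sound:
  assumes "scoped D" "fresh_bool x D" "temporal x \<rho> \<delta> Js"
    and \<psi>: "quant_free \<psi>" "\<forall>a \<in> pform_asserts \<psi>. over (vars D) a"
    and replace: "replace_path \<rho> (PState (Asrt (bvar x 0))) \<psi> \<psi>'" "\<psi>' \<noteq> \<psi>"
    and clause: "clause_true M I (Clause (init D) [PV x 0] (app aux (vars D @ [x]) [0]))"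
    and models: "models_in M I (extend D x (app aux (vars D @ [x]) [0]) \<delta> Js) (Quant QEf \<psi>')"
  shows "models_in M I D (Quant QEf \<psi>)"
  unfolding models_in_def sat_state.simps quant.case
proof (intro ballI impI)
  fix s assume s: "s \<in> states M D" "holds_at M I s (init D)"
  let ?D = "extend D x (app aux (vars D @ [x]) [0]) \<delta> Js"
  have \<rho>: "\<forall>a \<in> pform_asserts \<rho>. over (vars D) a"
    using replace_path_asserts[OF replace(1)] replace(2) \<psi>(2) by blast
  have x: "pvar_sort x = Boolean" "x \<notin> set (vars D)" using assms(2) by (auto simp: fresh_bool_def)
  obtain \<tau> where \<tau>: "well_sorted M \<tau>"
      "\<And>y k. y \<in> set (vars D) \<Longrightarrow> PV y k \<notin> set [PV x 0] \<Longrightarrow> \<tau> (PV y k) = s y"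
      "sem M I \<tau> (app aux (vars D @ [x]) [0])"
    using s assms(1) by (elim clause_true_exD[OF clause]) (auto simp: sem_clause_val scoped_def)
  define s' where "s' = restrict (\<lambda>y. \<tau> (PV y 0)) (set (vars ?D))"
  have "s' \<in> states M ?D" unfolding s'_def by (rule state_of_valuation[OF \<tau>(1)])
  moreover have "map s' (vars D @ [x]) = map (\<lambda>y. \<tau> (PV y 0)) (vars D @ [x])"
    by (simp add: s'_def)
  then have "holds_at M I s' (init ?D)" using \<tau>(3)
    by (simp only: extend_simps holds_at_app sem_app list.map concat.simps append_Nil2)
  ultimately obtain \<pi>' where \<pi>': "fair_path M I ?D \<pi>'" "\<pi>' 0 = s'" "sat_path M I ?D \<pi>' \<psi>'"
    using models by (auto simp: models_in_def)
  define \<pi> where "\<pi> i = restrict (\<pi>' i) (set (vars D))" for i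
  have agree: "\<pi>' i y = \<pi> i y" if "y \<in> set (vars D)" for i y
    using that by (simp add: \<pi>_def)
  have in_states': "\<pi>' i \<in> states M ?D" for i using \<pi>' by (auto simp: fair_path_def is_path_def)
  have in_states: "\<pi> i \<in> states M D" for i
    using in_states'[of i] unfolding states_extend_iff by (auto simp: \<pi>_def states_def)
  have labels: "labels M I D x \<rho> \<pi>'" and "fair_path M I D \<pi>"
    using \<pi>'(1) by (simp_all add: fair_path_extend[OF assms(1,3) \<rho> agree in_states' in_states])
  moreover have "sat_path M I D \<pi> \<psi>"
    using replace_path_extend_sat[OF \<psi> replace(1) labels agree] \<pi>'(3) by blast
  \<comment> \<open>On the old variables \<open>\<tau>\<close> keeps the values of \<open>s\<close>,
    as only \<open>PV x 0\<close> is quantified. Elsewhere both states take the default value of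
    extensional functions.\<close>
  moreover have "\<pi> 0 = s"
  proof
    fix y show "\<pi> 0 y = s y"
    proof (cases "y \<in> set (vars D)")
      case True
      then have "\<tau> (PV y 0) = s y" using x(2) by (intro \<tau>(2)) auto
      with True show ?thesis using \<pi>'(2) by (simp add: \<pi>_def s'_def)
    next
      case False
      with s(1) show ?thesis by (simp add: \<pi>_def states_def PiE_arb[of s])
    qed
  qed
  ultimately show "\<exists>\<pi>. fair_path M I D \<pi> \<and> \<pi> 0 = s \<and> sat_path M I D \<pi> \<psi>" by blast
qed


section \<open>Fair paths and disjunctive well-foundedness\<close>

text \<open>The well-founded parts of \<open>R\<close> are pulled back along \<open>f\<close>. If
  all pairs were in \<open>R\<close>, finitely many such pullbacks would cover the transitive
  relation \<open>?gt\<close>, and the Ramsey argument behind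
  \<open>trans_disj_wf_implies_wf\<close> would make it well-founded, although 0, 1, 2, ... descends
  in it.\<close>

lemma disjunctively_wf_no_transitive_chain:
  fixes f :: "nat \<Rightarrow> 'a"
  assumes "disjunctively_wf R"
  shows "\<exists>m n. m < n \<and> (f m, f n) \<notin> R"
proof (rule ccontr)
  assume chain: "\<nexists>m n. m < n \<and> (f m, f n) \<notin> R"
  obtain \<W> where \<W>: "finite \<W>" "\<forall>W \<in> \<W>. wf (W\<inverse>)" "R \<subseteq> \<Union> \<W>"
    using assms by (auto simp: disjunctively_wf_def)
  from \<W>(1) obtain T and n :: nat where T: "\<W> = T ` {i. i < n}"
    by (auto simp: finite_conv_nat_seg_image)
  let ?gt = "{(j, i). i < (j::nat)}"
  have "?gt \<subseteq> (\<Union>i<n. inv_image ((T i)\<inverse>) f)"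
    using chain \<W>(3) T by (fastforce simp: inv_image_def)
  moreover have "\<forall>i<n. wf (inv_image ((T i)\<inverse>) f)" using \<W>(2) T by auto
  ultimately have "disj_wf ?gt"
    unfolding disj_wf by (intro exI[of _ "\<lambda>i. inv_image ((T i)\<inverse>) f"] exI[of _ n] conjI)
  moreover have "trans ?gt" by (auto intro: transI)
  ultimately have "wf ?gt" by (intro trans_disj_wf_implies_wf)
  then show False unfolding wf_iff_no_infinite_down_chain by auto
qed

text \<open>Gives the positions of one round, in which the conditions \<open>P i\<close> are met one
  after the other. The values of \<open>g\<close> beyond \<open>k\<close> are arbitrary.\<close>

lemma infinitely_often_in_order:
  fixes k n :: nat
  assumes "\<And>i. i < k \<Longrightarrow> infinite {j::nat. P i j}"
  shows "\<exists>g. g 0 = n \<and> (\<forall>i<k. g i < g (Suc i) \<and> P i (g (Suc i)))"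
proof -
  have "\<exists>g. \<forall>i. (i = 0 \<longrightarrow> g i = n) \<and> (i < k \<longrightarrow> g i < g (Suc i) \<and> P i (g (Suc i)))"
  proof (rule dependent_nat_choice)
    fix m i :: nat
    show "\<exists>m'. (Suc i = 0 \<longrightarrow> m' = n) \<and> (i < k \<longrightarrow> m < m' \<and> P i m')"
      using assms[of i] by (auto simp: infinite_nat_iff_unbounded)
  qed simp
  then show ?thesis by blast
qed

text \<open>The path is sampled once per completed round of fairness conditions, or at every
  position if there are none. The third clause relates any two samples by \<open>r\<close>, so they
  form the forbidden chain.\<close>

lemma clauses_Af_sound:
  assumes clauses: "\<forall>cl \<in> clauses_Af D c p r t. clause_true M I cl"
    and scope: "scoped D" "over (vars D) c"
    and arity: "arity r = 2 * length (vars D)"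
    and \<pi>: "fair_path M I D \<pi>" and init: "holds_at M I (\<pi> 0) (init D)"
  shows "holds_at M I (\<pi> 0) c"
proof (rule ccontr)
  assume "\<not> holds_at M I (\<pi> 0) c"
  let ?v = "vars D" and ?k = "length (fair D)"
  have D: "over ?v (init D)" "over2 ?v (nxt D)" "\<And>j. j \<in> set (fair D) \<Longrightarrow> over ?v j"
    using scope(1) by (auto simp: scoped_def)
  have path: "\<pi> i \<in> states M D" "holds_step M I (\<pi> i) (\<pi> (Suc i)) (nxt D)" for i
    using \<pi> by (auto simp: fair_path_def is_path_def step_iff)
  \<comment> \<open>\<open>S\<close> says which position of the path is assigned to each copy of the
    program variables in a clause.\<close>
  have inst: "sem M I (clause_val M ?v (\<lambda>k. \<pi> (S k))) h"
    if "Clause b [] h \<in> clauses_Af D c p r t" "sem M I (clause_val M ?v (\<lambda>k. \<pi> (S k))) b" for b h S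
    by (rule clause_trueD[where S = "\<lambda>k. \<pi> (S k)", OF bspec[OF clauses that(1)] path(1) that(2)])
  have p: "map (\<pi> n) ?v \<in> I p" for n
  proof (induction n)
    case 0
    show ?case
      using inst[of "Conj (init D) (Neg c)" "app p ?v [0]" "\<lambda>_. 0"] init \<open>\<not> holds_at M I (\<pi> 0) c\<close>
      by (auto simp: clauses_Af_def Let_def sem_clause_val_app sem_clause_val D scope)
  next
    case (Suc n)
    then show ?case
      using inst[of "Conj (nxt D) (app p ?v [0])" "app p ?v [1]" "\<lambda>k. n + k"] path
      by (auto simp: clauses_Af_def Let_def sem_clause_val_app sem_clause_val_step D)
  qed
  have t1: "map (\<pi> n) ?v @ map (\<pi> (Suc n)) ?v \<in> I t" for n
    using inst[of "nxt D" "app t ?v [0, 1]" "\<lambda>k. n + k"] path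
    by (auto simp: clauses_Af_def Let_def sem_clause_val_app sem_clause_val_step D)
  have t: "map (\<pi> m) ?v @ map (\<pi> n) ?v \<in> I t" if "m < n" for m n
    using that
  proof (induction n)
    case (Suc n)
    show ?case
    proof (cases "m = n")
      case False
      then have "map (\<pi> m) ?v @ map (\<pi> n) ?v \<in> I t" using Suc by simp
      then show ?thesis
        using inst[of "Conj (app t ?v [0, 1]) (shift 1 (nxt D))" "app t ?v [0, 2]"
            "\<lambda>k. if k = 0 then m else if k = 1 then n else Suc n"] path
        by (auto simp: clauses_Af_def Let_def sem_clause_val_app sem_clause_val_step_shift D)
    qed (use t1 in simp)
  qed simp
  have "\<exists>N. \<forall>m n :: nat. m < n \<longrightarrow> map (\<pi> (N m)) ?v @ map (\<pi> (N n)) ?v \<in> I r"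
  proof (cases "fair D = []")
    case True
    have r: "map (\<pi> m) ?v @ map (\<pi> n) ?v \<in> I r" if "m < n" for m n
      using inst[of "Conj (app p ?v [0]) (app t ?v [0, 1])" "app r ?v [0, 1]"
          "\<lambda>k. if k = 0 then m else n"] p t[OF that] True
      by (auto simp: clauses_Af_def Let_def sem_clause_val_app)
    show ?thesis by (rule exI[of _ "\<lambda>n. n"]) (simp add: r)
  next
    case False
    have "infinite {n. holds_at M I (\<pi> n) (fair D ! i)}" if "i < ?k" for i
      using \<pi> that by (auto simp: fair_path_def)
    then have "\<forall>n. \<exists>g. g 0 = n \<and>
        (\<forall>i<?k. g i < g (Suc i) \<and> holds_at M I (\<pi> (g (Suc i))) (fair D ! i))"
      by (intro allI infinitely_often_in_order)
    then obtain G where G: "\<And>n. G n 0 = n"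
        "\<And>n i. i < ?k \<Longrightarrow> G n i < G n (Suc i) \<and> holds_at M I (\<pi> (G n (Suc i))) (fair D ! i)"
      by metis
    \<comment> \<open>Each sample is the end of a round started at the previous one, so the last
      fairness condition holds at every sample after \<open>N 0\<close>.\<close>
    define N where "N = rec_nat 0 (\<lambda>_ n. G n ?k)"
    have N_Suc: "N (Suc m) = G (N m) ?k" for m by (simp add: N_def)
    obtain l where l: "?k = Suc l" using False by (cases "fair D") auto
    have G_mono: "i \<le> ?k \<Longrightarrow> G n 0 \<le> G n i" for n i
    proof (induction i)
      case (Suc i)
      then show ?case using G(2)[of i n] by simp
    qed simp
    have "N m < N (Suc m)" for m
      using G(2)[of l "N m"] G_mono[of l "N m"] G(1)[of "N m"] l by (simp add: N_Suc)
    then have "mono N" by (simp add: mono_iff_le_Suc less_imp_le)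
    have "map (\<pi> (N m)) ?v @ map (\<pi> (N n)) ?v \<in> I r" if "m < n" for m n
    proof -
      \<comment> \<open>The round started at \<open>N m\<close> is followed up to its last but one
        condition; then the sequence jumps to \<open>N n\<close>. There the last condition holds as
        well, because \<open>N n\<close> ends the round started at the sample before it.\<close>
      define S where "S i = (if i = ?k then N n else G (N m) i)" for i
      obtain n' where n': "n = Suc n'" using \<open>m < n\<close> by (cases n) auto
      have "G (N m) ?k \<le> N n" using \<open>mono N\<close> \<open>m < n\<close> by (metis N_Suc Suc_leI monoD)
      then have S: "S i < S (Suc i)" "holds_at M I (\<pi> (S (Suc i))) (fair D ! i)" if "i < ?k" for i
        using that G(2)[of i "N m"] G(2)[of l "N n'"] l n' N_Suc[of n'] by (auto simp: S_def)
      have "sem M I (clause_val M ?v (\<lambda>k. \<pi> (S k)))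
          (Conj (app t ?v [i, Suc i]) (shift (Suc i) (fair D ! i)))" if "i < ?k" for i
        using S[OF that] t D(3)[OF nth_mem[OF that]]
        by (simp add: sem_clause_val_shift sem_clause_val_app)
      moreover have "sem M I (clause_val M ?v (\<lambda>k. \<pi> (S k))) (app p ?v [0])"
        using p by (simp add: sem_clause_val_app)
      ultimately have "sem M I (clause_val M ?v (\<lambda>k. \<pi> (S k)))
         (Conj (app p ?v [0])
           (conjs (map (\<lambda>i. Conj (app t ?v [i, Suc i]) (shift (Suc i) (fair D ! i))) [0..<?k])))"
        unfolding sem.simps(7) sem_conjs by auto
      from inst[where S = S, OF _ this, of "app r ?v [0, ?k]"] False
      have "sem M I (clause_val M ?v (\<lambda>k. \<pi> (S k))) (app r ?v [0, ?k])"
        by (simp add: clauses_Af_def Let_def)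
      moreover have "S 0 = N m" "S ?k = N n" using l G(1) by (simp_all add: S_def)
      ultimately show ?thesis by (simp add: sem_clause_val_app)
    qed
    then show ?thesis by blast
  qed
  then obtain N where N: "\<forall>m n :: nat. m < n \<longrightarrow> map (\<pi> (N m)) ?v @ map (\<pi> (N n)) ?v \<in> I r" ..
  have "disjunctively_wf (state_rel I r)"
    using clauses by (auto simp: clauses_Af_def Let_def)
  from disjunctively_wf_no_transitive_chain[OF this, of "\<lambda>n. map (\<pi> (N n)) ?v"] show False
    using N by (auto simp: state_rel_def arity)
qed

text \<open>Inside \<open>q\<close> a step that stays in \<open>q\<close> is always possible, and
  dependent choice strings such steps together. As \<open>c\<close> is an assertion, it is settled
  in the initial state, and the path only has to exist.\<close>

lemma clauses_Ef_nofair_sound: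
  assumes clauses: "\<forall>cl \<in> clauses_Ef_nofair D c q. clause_true M I cl"
    and scope: "scoped D" "over (vars D) c" and "fair D = []"
    and s: "s \<in> states M D" "holds_at M I s (init D)"
  shows "holds_at M I s c \<and> (\<exists>\<pi>. fair_path M I D \<pi> \<and> \<pi> 0 = s)"
proof -
  let ?v = "vars D"
  have D: "over ?v (init D)" "over2 ?v (nxt D)"
    using scope(1) by (auto simp: scoped_def)
  have "sem M I (clause_val M ?v (\<lambda>_. s)) (Conj c (app q ?v [0]))"
    using clauses by (intro clause_init_trueD[OF _ D(1) s]) (auto simp: clauses_Ef_nofair_def Let_def)
  then have init: "holds_at M I s c" "map s ?v \<in> I q"
    using sem_clause_val[OF scope(2), of M I] by (auto simp: sem_clause_val_app)
  have "\<exists>\<pi>. \<forall>n. (\<pi> n \<in> states M D \<and> map (\<pi> n) ?v \<in> I q \<and> (n = 0 \<longrightarrow> \<pi> n = s)) \<and>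
      step M I D (\<pi> n) (\<pi> (Suc n))"
  proof (rule dependent_nat_choice)
    show "\<exists>u. u \<in> states M D \<and> map u ?v \<in> I q \<and> (0 = (0::nat) \<longrightarrow> u = s)" using s init by auto
  next
    fix u and n :: nat
    assume u: "u \<in> states M D \<and> map u ?v \<in> I q \<and> (n = 0 \<longrightarrow> u = s)"
    have "clause_true M I (Clause (app q ?v [0]) (copies ?v 1) (Conj (nxt D) (app q ?v [1])))"
      using clauses by (auto simp: clauses_Ef_nofair_def Let_def)
    then obtain \<tau> where \<tau>: "well_sorted M \<tau>"
        "\<And>y k. y \<in> set ?v \<Longrightarrow> PV y k \<notin> set (copies ?v 1) \<Longrightarrow> \<tau> (PV y k) = u y"
        "sem M I \<tau> (Conj (nxt D) (app q ?v [1]))"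
      using u by (elim clause_true_exD) (auto simp: sem_clause_val_app)
    define u' where "u' = restrict (\<lambda>x. \<tau> (PV x 1)) (set ?v)"
    have "u' \<in> states M D" unfolding u'_def by (rule state_of_valuation[OF \<tau>(1)])
    moreover have "step M I D u u'"
    proof -
      have "sem M I \<tau> (nxt D) \<longleftrightarrow> holds_step M I u u' (nxt D)"
        using D(2) by (rule sem_holds_step) (auto simp: \<tau>(2) in_copies u'_def)
      then show ?thesis using \<tau>(3) by (simp add: step_iff)
    qed
    moreover have "sem M I \<tau> (app q ?v [1]) \<longleftrightarrow> map u' ?v \<in> I q"
      using sem_app_agree[of "[1]" ?v \<tau> "\<lambda>_. u'" M I q] by (simp add: u'_def)
    then have "map u' ?v \<in> I q" using \<tau>(3) by simp
    ultimately show "\<exists>u'. (u' \<in> states M D \<and> map u' ?v \<in> I q \<and> (Suc n = 0 \<longrightarrow> u' = s)) \<and>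
        step M I D u u'" by auto
  qed
  then show ?thesis using init assms(4) by (auto simp: fair_path_def is_path_def)
qed

text \<open>Each state is paired with the index of the fairness condition currently awaited. A step
  either meets this condition and moves on to the next index, or waits along the transitive relation
  \<open>rs ! i\<close>. Waiting must end, so all indices are visited cyclically.\<close>

lemma clauses_Ef_fair_sound:
  assumes clauses: "\<forall>cl \<in> clauses_Ef_fair D c qs rs. clause_true M I cl"
    and scope: "scoped D" "over (vars D) c" and "fair D \<noteq> []"
    and arity: "\<And>i. i < length (fair D) \<Longrightarrow> arity (rs ! i) = 2 * length (vars D)"
    and s: "s \<in> states M D" "holds_at M I s (init D)"
  shows "holds_at M I s c \<and> (\<exists>\<pi>. fair_path M I D \<pi> \<and> \<pi> 0 = s)"
proof -
  let ?v = "vars D"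
  define k where "k = length (fair D)"
  have "k > 0" using assms(4) by (simp add: k_def)
  have D: "over ?v (init D)" "over2 ?v (nxt D)" "\<And>j. j \<in> set (fair D) \<Longrightarrow> over ?v j"
    using scope(1) by (auto simp: scoped_def)
  have "sem M I (clause_val M ?v (\<lambda>_. s)) (Conj c (app (qs ! 0) ?v [0]))"
    using clauses by (intro clause_init_trueD[OF _ D(1) s]) (auto simp: clauses_Ef_fair_def Let_def)
  then have init: "holds_at M I s c" "map s ?v \<in> I (qs ! 0)"
    using sem_clause_val[OF scope(2), of M I] by (auto simp: sem_clause_val_app)
  \<comment> \<open>\<open>R\<close> describes a waiting step and \<open>adv\<close> an advancing
    one. With a single fairness condition an advance leaves the index unchanged, so progress is
    expressed through \<open>adv\<close> and not through a change of index.\<close>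
  define R where "R i u u' \<longleftrightarrow> map u ?v @ map u' ?v \<in> I (rs ! i)" for i u u'
  define adv where "adv i u i' \<longleftrightarrow> holds_at M I u (fair D ! i) \<and> i' = Suc i mod k" for i u i'
  define good where "good i u \<longleftrightarrow> i < k \<and> u \<in> states M D \<and> map u ?v \<in> I (qs ! i)" for i u
  have next_state: "\<exists>i' u'. good i' u' \<and> step M I D u u' \<and> (adv i u i' \<or> i' = i \<and> R i u u')"
    if good: "good i u" for i u
  proof -
    have i: "i < length (fair D)" using good by (simp add: good_def k_def)
    have "clause_true M I (Clause (app (qs ! i) ?v [0]) (copies ?v 1)
        (Conj (nxt D) (Disj (Conj (fair D ! i) (app (qs ! (Suc i mod k)) ?v [1]))
          (Conj (app (rs ! i) ?v [0, 1]) (app (qs ! i) ?v [1])))))"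
      using clauses i by (auto simp: clauses_Ef_fair_def Let_def k_def)
    then obtain \<tau> where \<tau>: "well_sorted M \<tau>"
        "\<And>y k. y \<in> set ?v \<Longrightarrow> PV y k \<notin> set (copies ?v 1) \<Longrightarrow> \<tau> (PV y k) = u y"
        "sem M I \<tau> (Conj (nxt D) (Disj (Conj (fair D ! i) (app (qs ! (Suc i mod k)) ?v [1]))
          (Conj (app (rs ! i) ?v [0, 1]) (app (qs ! i) ?v [1]))))"
      using good by (elim clause_true_exD) (auto simp: sem_clause_val_app good_def)
    define u' where "u' = restrict (\<lambda>x. \<tau> (PV x 1)) (set ?v)"
    have "u' \<in> states M D" unfolding u'_def by (rule state_of_valuation[OF \<tau>(1)])
    moreover have "sem M I \<tau> (nxt D) \<longleftrightarrow> holds_step M I u u' (nxt D)"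
      using D(2) by (rule sem_holds_step) (auto simp: \<tau>(2) in_copies u'_def)
    moreover have "sem M I \<tau> (fair D ! i) \<longleftrightarrow> holds_at M I u (fair D ! i)"
      using D(3)[OF nth_mem[OF i]] by (rule sem_holds_at) (auto simp: \<tau>(2) in_copies)
    moreover have "sem M I \<tau> (app p ?v [1]) \<longleftrightarrow> map u' ?v \<in> I p" for p
      using sem_app_agree[of "[1]" ?v \<tau> "\<lambda>_. u'" M I p] by (simp add: u'_def)
    moreover have "sem M I \<tau> (app p ?v [0, 1]) \<longleftrightarrow> map u ?v @ map u' ?v \<in> I p" for p
    proof -
      have "\<tau> (PV y k) = (if k = 0 then u else u') y" if "k \<in> set [0, 1]" "y \<in> set ?v" for k y
        using that by (auto simp: u'_def \<tau>(2) in_copies)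
      then show ?thesis
        using sem_app_agree[of "[0, 1]" ?v \<tau> "\<lambda>k. if k = 0 then u else u'" M I p] by simp
    qed
    moreover have "Suc i mod k < k" "i < k" using \<open>k > 0\<close> i by (auto simp: k_def)
    ultimately have "good (Suc i mod k) u' \<and> adv i u (Suc i mod k) \<or> good i u' \<and> R i u u'"
        "step M I D u u'"
      using \<tau>(3) unfolding sem.simps step_iff good_def adv_def R_def by blast+
    then show ?thesis by blast
  qed
  have "\<exists>f. \<forall>n. (good (fst (f n)) (snd (f n)) \<and> (n = 0 \<longrightarrow> f n = (0, s))) \<and>
      (step M I D (snd (f n)) (snd (f (Suc n))) \<and>
       (adv (fst (f n)) (snd (f n)) (fst (f (Suc n))) \<or>
        fst (f (Suc n)) = fst (f n) \<and> R (fst (f n)) (snd (f n)) (snd (f (Suc n)))))"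
  proof (rule dependent_nat_choice)
    show "\<exists>x. good (fst x) (snd x) \<and> (0 = (0::nat) \<longrightarrow> x = (0, s))"
      using s init \<open>k > 0\<close> by (auto simp: good_def)
  next
    fix x and n :: nat assume "good (fst x) (snd x) \<and> (n = 0 \<longrightarrow> x = (0, s))"
    then show "\<exists>y. (good (fst y) (snd y) \<and> (Suc n = 0 \<longrightarrow> y = (0, s))) \<and>
        (step M I D (snd x) (snd y) \<and>
         (adv (fst x) (snd x) (fst y) \<or> fst y = fst x \<and> R (fst x) (snd x) (snd y)))"
      using next_state[of "fst x" "snd x"] by auto
  qed
  then obtain f where f: "good (fst (f n)) (snd (f n))" "f 0 = (0, s)"
      "step M I D (snd (f n)) (snd (f (Suc n)))"
      "adv (fst (f n)) (snd (f n)) (fst (f (Suc n))) \<or>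
        fst (f (Suc n)) = fst (f n) \<and> R (fst (f n)) (snd (f n)) (snd (f (Suc n)))" for n
    by blast
  define ix where "ix n = fst (f n)" for n
  define \<pi> where "\<pi> n = snd (f n)" for n
  have states: "\<pi> n \<in> states M D" and ix: "ix n < k" for n
    using f(1)[of n] by (auto simp: good_def \<pi>_def ix_def)
  have adv: "adv (ix n) (\<pi> n) (ix (Suc n)) \<or> ix (Suc n) = ix n \<and> R (ix n) (\<pi> n) (\<pi> (Suc n))" for n
    using f(4)[of n] by (simp add: ix_def \<pi>_def)
  \<comment> \<open>The transitivity clause is used under well-sorted valuations, hence the
    assumptions that all three points are states.\<close>
  have R_trans: "R i a c" if "R i a b" "R i b c" "i < k" "a \<in> states M D" "b \<in> states M D" "c \<in> states M D"
    for i a b c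
  proof -
    have "sem M I (clause_val M ?v (\<lambda>k. if k = 0 then a else if k = 1 then b else c)) (app (rs ! i) ?v [0, 2])"
    proof (rule clause_trueD)
      show "clause_true M I (Clause (Conj (app (rs ! i) ?v [0, 1]) (app (rs ! i) ?v [1, 2])) []
          (app (rs ! i) ?v [0, 2]))"
        using clauses \<open>i < k\<close> by (auto simp: clauses_Ef_fair_def Let_def k_def)
    qed (use that in \<open>auto simp: sem_clause_val_app R_def\<close>)
    then show ?thesis by (simp add: sem_clause_val_app R_def)
  qed
  \<comment> \<open>An index that never advances is constant, and transitivity turns the waiting
    steps into a chain in \<open>rs ! ix N\<close>.\<close>
  have progress: "\<exists>n \<ge> N. ix n = ix N \<and> adv (ix n) (\<pi> n) (ix (Suc n))" for N
  proof (rule ccontr)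
    assume stuck: "\<not> ?thesis"
    have const: "ix (N + m) = ix N" for m
    proof (induction m)
      case (Suc m)
      then show ?case using adv[of "N + m"] stuck by (metis add_Suc_right le_add1)
    qed simp
    have wait: "R (ix N) (\<pi> (N + m)) (\<pi> (N + Suc m))" for m
      using adv[of "N + m"] stuck const[of m] by (metis add_Suc_right le_add1)
    have chain: "R (ix N) (\<pi> (N + m)) (\<pi> (N + n))" if "m < n" for m n
      using that
    proof (induction n)
      case (Suc n)
      then show ?case using wait[of n] R_trans ix states by (metis less_Suc_eq)
    qed simp
    have "disjunctively_wf (state_rel I (rs ! ix N))"
      using clauses ix[of N] by (auto simp: clauses_Ef_fair_def Let_def k_def)
    from disjunctively_wf_no_transitive_chain[OF this, of "\<lambda>n. map (\<pi> (N + n)) ?v"] show False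
      using chain arity ix[of N] by (auto simp: state_rel_def R_def k_def)
  qed
  \<comment> \<open>After each advance the progress argument is restarted at the following position,
    where the next index is awaited.\<close>
  have cycle: "\<exists>n \<ge> N. ix n = (ix N + d) mod k \<and> adv (ix n) (\<pi> n) (ix (Suc n))" for N d
  proof (induction d)
    case 0
    then show ?case using progress[of N] ix[of N] by simp
  next
    case (Suc d)
    then obtain n where n: "n \<ge> N" "ix n = (ix N + d) mod k" "adv (ix n) (\<pi> n) (ix (Suc n))" by blast
    then have "ix (Suc n) = (ix N + Suc d) mod k" by (simp add: adv_def mod_Suc_eq)
    then show ?case using progress[of "Suc n"] n(1) by (metis Suc_leD order_trans)
  qed
  have "infinite {n. holds_at M I (\<pi> n) j}" if "j \<in> set (fair D)" for j
    unfolding infinite_nat_iff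
  proof
    fix N
    have "\<exists>i<k. fair D ! i = j" using that by (simp add: in_set_conv_nth k_def)
    then obtain i where i: "i < k" "fair D ! i = j" by blast
    \<comment> \<open>Since \<open>i\<close> may be smaller than \<open>ix N\<close>, the current
      cycle is first completed by \<open>k - ix N\<close> advances.\<close>
    have "(ix N + (k - ix N + i)) mod k = i" using ix[of N] i by simp
    then show "\<exists>n \<ge> N. holds_at M I (\<pi> n) j"
      using cycle[of N "k - ix N + i"] unfolding adv_def i(2)[symmetric] by auto
  qed
  then have "fair_path M I D \<pi>"
    using f(3) states by (auto simp: fair_path_def is_path_def \<pi>_def)
  moreover have "\<pi> 0 = s" by (simp add: \<pi>_def f(2))
  ultimately show ?thesis using init by blast
qed


section \<open>Soundness\<close>

text \<open>The scope conditions are the invariant, in place of \<open>program\<close> and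
  \<open>ctl_star_over\<close>: after a split the formula contains applications of
  \<open>aux\<close>, which \<open>ctl_star_over\<close> excludes.\<close>

lemma trans_run_sound:
  assumes "trans_run U D \<phi> C U'" "tt M \<noteq> ff M"
  shows "\<forall>cl \<in> C. clause_true M I cl \<Longrightarrow> scoped D \<Longrightarrow> \<forall>a \<in> sform_asserts \<phi>. over (vars D) a \<Longrightarrow>
    models_in M I D \<phi>"
  using assms(1)
proof (induction rule: trans_run.induct)
  case (split_state aux U D \<psi> q \<phi> \<phi>' C\<^sub>1 U\<^sub>1 C\<^sub>2 U\<^sub>2)
  let ?a = "app aux (vars D) [0]"
  let ?D = "D\<lparr>init := ?a\<rparr>"
  have over_a: "over (vars D) ?a" by (simp add: fv_app)
  note asserts = replace_state_asserts[OF split_state.hyps(4)]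
  have "sform_asserts (Quant q \<psi>) \<subseteq> sform_asserts \<phi>" using asserts split_state.hyps(5) by blast
  then have "\<forall>a \<in> sform_asserts (Quant q \<psi>). over (vars D) a" using split_state.prems(3) by blast
  moreover have "scoped ?D" using split_state.prems(2) over_a by (simp add: scoped_def)
  ultimately have "models_in M I ?D (Quant q \<psi>)"
    using split_state.IH(1) split_state.prems(1) by (auto simp: ball_Un)
  \<comment> \<open>Paths and fairness do not depend on the initial condition, so replacing it
    leaves satisfaction unchanged.\<close>
  moreover have eq: "sat_state M I ?D s \<chi> \<longleftrightarrow> sat_state M I D s \<chi>"
      "sat_path M I ?D \<pi> \<theta> \<longleftrightarrow> sat_path M I D \<pi> \<theta>" for s \<pi> \<chi> \<theta>
    by (induction \<chi> and \<theta> arbitrary: s and \<pi>)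
      (auto simp: fair_path_def is_path_def states_def step_def split: quant.split)
  \<comment> \<open>Thus \<open>aux\<close> underapproximates the replaced formula on all states of
    \<open>D\<close>, as \<open>replace_state_mono\<close> requires.\<close>
  ultimately have "sat_state M I D s (Quant q \<psi>)" if "s \<in> states M D" "sat_state M I D s (Asrt ?a)" for s
    using that unfolding models_in_def eq by (simp add: states_def)
  note mono = replace_state_mono[OF this split_state.hyps(4)]
  have "models_in M I D \<phi>'"
  proof (rule split_state.IH(2))
    show "\<forall>a \<in> sform_asserts \<phi>'. over (vars D) a"
    proof
      fix a assume "a \<in> sform_asserts \<phi>'"
      then have "a = ?a \<or> a \<in> sform_asserts \<phi>" using asserts by auto
      then show "over (vars D) a" using split_state.prems(3) over_a by blast
    qed
  qed (use split_state.prems in auto)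
  then show ?case using mono by (auto simp: models_in_def)
next
  case (make_fair_A \<psi> U D C U')
  have "models_in M I (D\<lparr>fair := []\<rparr>) (Quant QAf \<psi>)"
    using make_fair_A by (simp add: scoped_def)
  \<comment> \<open>Dropping the fairness conditions could only matter at path quantifiers, and
    \<open>\<psi>\<close> has none. The fair paths of the modified program are exactly the paths of
    \<open>D\<close>.\<close>
  moreover have "sat_path M I (D\<lparr>fair := []\<rparr>) \<pi> \<psi> \<longleftrightarrow> sat_path M I D \<pi> \<psi>" for \<pi>
    using make_fair_A.hyps(1) make_fair_A.prems(3)
    by (intro sat_path_quant_free_cong[where vs = "vars D"]) auto
  ultimately show ?case
    by (simp add: models_in_def fair_path_def is_path_def states_def step_def)
next
  case (make_fair_E \<psi> U D C U')
  have "models_in M I (D\<lparr>fair := []\<rparr>) (Quant QEf \<psi>)"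
    using make_fair_E by (simp add: scoped_def)
  moreover have "sat_path M I (D\<lparr>fair := []\<rparr>) \<pi> \<psi> \<longleftrightarrow> sat_path M I D \<pi> \<psi>" for \<pi>
    using make_fair_E.hyps(1) make_fair_E.prems(3)
    by (intro sat_path_quant_free_cong[where vs = "vars D"]) auto
  ultimately show ?case
    by (simp add: models_in_def fair_path_def is_path_def states_def step_def)
next
  case (temporal_Af \<psi> x D \<rho> \<delta> Js \<psi>' U C U')
  have \<psi>: "\<forall>a \<in> pform_asserts \<psi>. over (vars D) a" using temporal_Af.prems(3) by simp
  have "over (vars D @ [x]) (init D)"
    using temporal_Af.prems(2) over_append by (auto simp: scoped_def)
  note scope = extend_scope[OF temporal_Af.prems(2) temporal_Af.hyps(3-5) \<psi> this]
  have "models_in M I (extend D x (init D) \<delta> Js) (Quant QAf \<psi>')"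
    using temporal_Af.IH[folded extend_def] temporal_Af.prems(1) scope by simp
  then show ?case
    using temporal_Af_sound[OF assms(2) temporal_Af.prems(2) temporal_Af.hyps(2,3,1) \<psi>
        temporal_Af.hyps(4,5)] by blast
next
  case (temporal_Ef \<psi> x D \<rho> \<delta> Js \<psi>' aux U C U')
  have \<psi>: "\<forall>a \<in> pform_asserts \<psi>. over (vars D) a" using temporal_Ef.prems(3) by simp
  have "over (vars D @ [x]) (app aux (vars D @ [x]) [0])" by (simp add: fv_app)
  note scope = extend_scope[OF temporal_Ef.prems(2) temporal_Ef.hyps(3-5) \<psi> this]
  have "models_in M I (extend D x (app aux (vars D @ [x]) [0]) \<delta> Js) (Quant QEf \<psi>')"
    using temporal_Ef.IH[folded extend_def] temporal_Ef.prems(1) scope by simp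
  then show ?case
    using temporal_Ef_sound[OF temporal_Ef.prems(2) temporal_Ef.hyps(2,3,1) \<psi>
        temporal_Ef.hyps(4,5), of M I aux] temporal_Ef.prems(1) by simp
next
  case (assertion_Af \<psi> c p r t U D)
  have "over (vars D) c"
    using path_is_assertion_fv[OF assertion_Af.hyps(1)] assertion_Af.prems(3) by auto
  then show ?case
    using clauses_Af_sound[OF assertion_Af.prems(1,2)] assertion_Af.hyps
    by (auto simp: models_in_def path_is_assertion_sat[OF assertion_Af.hyps(1)])
next
  case (assertion_Ef_fair \<psi> c D qs rs U)
  have "over (vars D) c"
    using path_is_assertion_fv[OF assertion_Ef_fair.hyps(1)] assertion_Ef_fair.prems(3) by auto
  then have "holds_at M I s c \<and> (\<exists>\<pi>. fair_path M I D \<pi> \<and> \<pi> 0 = s)"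
    if "s \<in> states M D" "holds_at M I s (init D)" for s
    using clauses_Ef_fair_sound[OF assertion_Ef_fair.prems(1,2)] assertion_Ef_fair.hyps that by auto
  then show ?case
    by (auto simp: models_in_def path_is_assertion_sat[OF assertion_Ef_fair.hyps(1)])
next
  case (assertion_Ef_nofair \<psi> c D q U)
  have "over (vars D) c"
    using path_is_assertion_fv[OF assertion_Ef_nofair.hyps(1)] assertion_Ef_nofair.prems(3) by auto
  then have "holds_at M I s c \<and> (\<exists>\<pi>. fair_path M I D \<pi> \<and> \<pi> 0 = s)"
    if "s \<in> states M D" "holds_at M I s (init D)" for s
    using clauses_Ef_nofair_sound[OF assertion_Ef_nofair.prems(1,2)] assertion_Ef_nofair.hyps that by auto
  then show ?case
    by (auto simp: models_in_def path_is_assertion_sat[OF assertion_Ef_nofair.hyps(1)])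
next
  case (assertion_init \<phi> c U D)
  have c: "over (vars D) c"
    using state_is_assertion_fv[OF assertion_init.hyps(1)] assertion_init.prems(3) by auto
  show ?case unfolding models_in_def state_is_assertion_sat[OF assertion_init.hyps(1)]
  proof (intro ballI impI)
    fix s assume s: "s \<in> states M D" "holds_at M I s (init D)"
    then have "sem M I (clause_val M (vars D) (\<lambda>_. s)) c"
      using assertion_init.prems by (intro clause_init_trueD) (auto simp: scoped_def)
    then show "holds_at M I s c" by (simp add: sem_clause_val[OF c])
  qed
qed

section \<open>Independence of the interpretation, and the final theorem\<close>

lemma holds_at_psyms_empty: "psyms a = {} \<Longrightarrow> holds_at M I s a \<longleftrightarrow> holds_at M I' s a"
  unfolding holds_at_def by (rule sem_psyms_empty)

text \<open>The assumptions on the transition relation and the fairness conditions enter at path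
  quantifiers: they make the paths and the fair paths the same under both interpretations.\<close>

lemma
  assumes "psyms (nxt D) = {}" "\<forall>j \<in> set (fair D). psyms j = {}"
  shows sat_state_psyms_empty: "\<forall>a \<in> sform_asserts \<phi>. psyms a = {} \<Longrightarrow>
      sat_state M I D s \<phi> \<longleftrightarrow> sat_state M I' D s \<phi>"
    and sat_path_psyms_empty: "\<forall>a \<in> pform_asserts \<psi>. psyms a = {} \<Longrightarrow>
      sat_path M I D \<pi> \<psi> \<longleftrightarrow> sat_path M I' D \<pi> \<psi>"
proof (induction \<phi> and \<psi> arbitrary: s and \<pi>)
  case (Asrt a)
  then show ?case using holds_at_psyms_empty[of a] by simp
next
  case (Quant q \<psi>)
  have path: "is_path M I D \<pi> \<longleftrightarrow> is_path M I' D \<pi>" for \<pi>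
    unfolding is_path_def step_def using sem_psyms_empty[OF assms(1)] by blast
  moreover have "fair_path M I D \<pi> \<longleftrightarrow> fair_path M I' D \<pi>" for \<pi>
    unfolding fair_path_def path using assms(2) holds_at_psyms_empty[of _ M I _ I'] by auto
  ultimately show ?case using Quant by (cases q) simp_all
qed auto

theorem theorem2:
  fixes M :: "('f, 'r, 'e) struct"
    and D :: "('f, 'r) prog"
    and \<phi> :: "('f, 'r) sform"
    and C :: "('f, 'r) clause set"
  assumes "tt M \<noteq> ff M"
    and "program D"
    and "ctl_star_over (vars D) \<phi>"
    and "Trans_result D \<phi> C"
  shows "(psyms (init D) = {} \<longrightarrow> satisfiable M C \<longrightarrow> models M D \<phi>) \<and>
         (\<forall>I. solution M I C \<longrightarrow> models_in M I D \<phi>)"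
proof -
  have "scoped D" and nxt: "psyms (nxt D) = {}" and fair: "\<forall>j \<in> set (fair D). psyms j = {}"
    using assms(2) by (auto simp: program_def scoped_def assertion_over_def papp_over_def)
  moreover have "\<forall>a \<in> sform_asserts \<phi>. over (vars D) a"
    using assms(3) by (auto simp: ctl_star_over_def assertion_over_def)
  ultimately have sound: "models_in M I D \<phi>" if "solution M I C" for I
    using assms(1,4) that trans_run_sound[of _ D \<phi> C _ M I]
    by (auto simp: Trans_result_def solution_def)
  \<comment> \<open>A solution is one particular interpretation, while \<open>models\<close> asks
    for all of them. Without predicate symbols in the initial condition, the result carries over
    from one to all.\<close>
  have "models M D \<phi>" if init: "psyms (init D) = {}" and sat: "satisfiable M C"
  proof -
    obtain I where I: "models_in M I D \<phi>" using sound sat by (auto simp: satisfiable_def)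
    have asserts: "\<forall>a \<in> sform_asserts \<phi>. psyms a = {}"
      using assms(3) by (auto simp: ctl_star_over_def assertion_over_def)
    have "models_in M I' D \<phi>" for I'
      using I unfolding models_in_def sat_state_psyms_empty[OF nxt fair asserts, of M I _ I']
        holds_at_psyms_empty[OF init, of M I _ I'] .
    then show ?thesis by (simp add: models_def)
  qed
  with sound show ?thesis by blast
qed

end
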